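(* Let $n\geq 3$ and let $C\subset\mathbb{S}^{n-1}$ be a spherical $3$-distance $4$-design. Then either all inner products $\langle x,y\rangle$, $x,y\in C$, are rational, or $n=3$ and $C$ is isometric to the (vertex set of the) regular icosahedron.
   Context: $\mathbb{S}^{n-1}$ is the unit sphere in $\mathbb{R}^n$ with the standard inner product $\langle\cdot,\cdot\rangle$. A finite set $C\subset\mathbb{S}^{n-1}$ is a spherical $t$-design if $\frac{1}{\mu(\mathbb{S}^{n-1})}\int_{\mathbb{S}^{n-1}} f\,d\mu=\frac{1}{|C|}\sum_{x\in C}f(x)$ for every polynomial $f$ in $n$ variables of degree at most $t$, where $\mu$ is the surface measure. $C$ is $s$-distance if the set $A(C)=\{\langle x,y\rangle: x,y\in C,\ x\neq y\}$ has exactly $s$ elements. *)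

theory Defs
  imports "HOL-Analysis.Analysis"
begin

text \<open>
  The surface measure on the unit sphere of an \<open>n\<close>-dimensional Euclidean space, obtained from
  Lebesgue measure by polar coordinates: the measure of a Borel set \<open>A\<close> is \<open>n\<close> times the volume of
  the cone \<open>{r x | x \<in> A, 0 < r \<le> 1}\<close>. The factor \<open>n\<close> makes the total mass \<open>n vol(B\<^sup>n)\<close>,
  the surface area of the sphere.
\<close>

definition surface_measure :: "'a::euclidean_space measure" where
  "surface_measure =
     scale_measure (of_nat DIM('a))
       (distr (restrict_space lborel (cball 0 1 - {0})) (restrict_space borel (sphere 0 1))
          (\<lambda>x. x /\<^sub>R norm x))"

lemma space_surface_measure: "space surface_measure = sphere (0::'a::euclidean_space) 1"
  by (simp add: surface_measure_def space_scale_measure space_restrict_space)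

lemma emeasure_surface_measure:
  assumes "A \<in> sets (borel :: 'a::euclidean_space measure)" "A \<subseteq> sphere 0 1"
  shows "emeasure surface_measure A =
    of_nat DIM('a) * emeasure lborel {r *\<^sub>R x | r x. 0 < r \<and> r \<le> 1 \<and> x \<in> A}"
proof -
  let ?D = "cball (0::'a) 1 - {0}"
  have D: "?D \<in> sets borel"
    by simp
  have "(\<lambda>x. x /\<^sub>R norm x) \<in> borel_measurable (restrict_space lborel ?D)"
    by (intro measurable_restrict_space1) simp
  then have m: "(\<lambda>x. x /\<^sub>R norm x) \<in>
      measurable (restrict_space lborel ?D) (restrict_space borel (sphere 0 1))"
    by (intro measurable_restrict_space2) (auto simp: space_restrict_space)
  have A: "A \<in> sets (restrict_space borel (sphere 0 1))"
    using assms by (auto simp: sets_restrict_space_iff)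
  have "(\<lambda>x. x /\<^sub>R norm x) -` A \<inter> ?D = {r *\<^sub>R x | r x. 0 < r \<and> r \<le> 1 \<and> x \<in> A}"
    (is "?L = ?R")
  proof (intro equalityI subsetI)
    fix y assume y: "y \<in> ?L"
    then have "y = norm y *\<^sub>R (y /\<^sub>R norm y)" "0 < norm y" "norm y \<le> 1"
      by auto
    with y show "y \<in> ?R" by blast
  next
    fix y assume "y \<in> ?R"
    then obtain r x where "y = r *\<^sub>R x" "0 < r" "r \<le> 1" "x \<in> A" by blast
    moreover from this have "norm x = 1" using assms by auto
    ultimately show "y \<in> ?L" by auto
  qed
  moreover from this have "?R \<subseteq> ?D"
    by (metis Int_lower2)
  ultimately show ?thesis
    using D by (simp add: surface_measure_def emeasure_distr[OF m A] space_restrict_space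
        emeasure_restrict_space)
qed

text \<open>
  Multi-indices are functions \<open>\<alpha> :: 'n \<Rightarrow> nat\<close>; those with \<open>sum \<alpha> UNIV \<le> t\<close> form a finite set.
\<close>

definition polynomial_deg_le :: "nat \<Rightarrow> (real^'n \<Rightarrow> real) \<Rightarrow> bool" where
  "polynomial_deg_le t f \<longleftrightarrow>
     (\<exists>c :: ('n \<Rightarrow> nat) \<Rightarrow> real.
        \<forall>x. f x = (\<Sum>\<alpha> | sum \<alpha> UNIV \<le> t. c \<alpha> * (\<Prod>i\<in>UNIV. (x $ i) ^ \<alpha> i)))"

lemma finite_multi_indices: "finite {\<alpha> :: 'n::finite \<Rightarrow> nat. sum \<alpha> UNIV \<le> t}"
proof (rule finite_subset)
  show "{\<alpha> :: 'n \<Rightarrow> nat. sum \<alpha> UNIV \<le> t} \<subseteq> Pi\<^sub>E UNIV (\<lambda>_. {..t})"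
  proof
    fix \<alpha> :: "'n \<Rightarrow> nat" assume "\<alpha> \<in> {\<alpha>. sum \<alpha> UNIV \<le> t}"
    moreover have "\<alpha> i \<le> sum \<alpha> UNIV" for i
      by (rule member_le_sum) simp_all
    ultimately show "\<alpha> \<in> Pi\<^sub>E UNIV (\<lambda>_. {..t})"
      by (simp add: PiE_UNIV_domain Pi_iff) (meson order_trans)
  qed
  show "finite (Pi\<^sub>E (UNIV :: 'n set) (\<lambda>_. {..t}))"
    by (intro finite_PiE) simp_all
qed

definition spherical_design :: "nat \<Rightarrow> (real^'n) set \<Rightarrow> bool" where
  "spherical_design t C \<longleftrightarrow> finite C \<and> C \<subseteq> sphere 0 1 \<and>
     (\<forall>f. polynomial_deg_le t f \<longrightarrow>
        1 / measure surface_measure (sphere (0 :: real^'n) 1) * (LINT x|surface_measure. f x)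
          = 1 / card C * (\<Sum>x\<in>C. f x))"

definition inner_products :: "(real^'n) set \<Rightarrow> real set" where
  "inner_products C = {x \<bullet> y | x y. x \<in> C \<and> y \<in> C \<and> x \<noteq> y}"

definition distance_set :: "nat \<Rightarrow> (real^'n) set \<Rightarrow> bool" where
  "distance_set s C \<longleftrightarrow> finite C \<and> card (inner_products C) = s"

definition isometric_sets :: "'a::metric_space set \<Rightarrow> 'b::metric_space set \<Rightarrow> bool" where
  "isometric_sets A B \<longleftrightarrow>
     (\<exists>f. bij_betw f A B \<and> (\<forall>x\<in>A. \<forall>y\<in>A. dist (f x) (f y) = dist x y))"

definition golden_ratio :: real where
  "golden_ratio = (1 + sqrt 5) / 2"

text \<open>
  The cyclic permutations of \<open>(0, \<plusminus>1, \<plusminus>\<phi>)\<close>, scaled to have circumradius 1.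
\<close>

definition icosahedron :: "(real^3) set" where
  "icosahedron =
     (\<Union>a\<in>{1, -1}. \<Union>b\<in>{golden_ratio, - golden_ratio}.
        (\<lambda>v. v /\<^sub>R sqrt (1 + golden_ratio\<^sup>2)) `
          {vector [0, a, b], vector [b, 0, a], vector [a, b, 0]})"

lemma icosahedron_subset_sphere: "icosahedron \<subseteq> sphere 0 1"
proof
  fix w assume "w \<in> icosahedron"
  then obtain a b :: real and v :: "real^3"
    where "a \<in> {1, -1}" "b \<in> {golden_ratio, - golden_ratio}"
      and v: "v \<in> {vector [0, a, b], vector [b, 0, a], vector [a, b, 0]}"
      and w: "w = v /\<^sub>R sqrt (1 + golden_ratio\<^sup>2)"
    unfolding icosahedron_def by (elim UN_E imageE)
  then have ab: "a\<^sup>2 = 1" "b\<^sup>2 = golden_ratio\<^sup>2"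
    by auto
  have "norm v = sqrt (1 + golden_ratio\<^sup>2)"
    using v ab by (auto simp: norm_vec_def L2_set_def sum_3)
  moreover have "sqrt (1 + golden_ratio\<^sup>2) > 0"
    by (simp add: add_pos_nonneg)
  ultimately show "w \<in> sphere 0 1"
    by (simp add: w)
qed

end

theory Submission
  imports Defs
begin

text \<open>
  A 3-distance 4-design carries an association scheme whose idempotents are zonal polynomials of
  degree at most 2, together with a complementary idempotent of rank \<open>m3\<close>. For an inner product \<open>a\<close> of
  valency \<open>k\<close>, the adjacency matrix divided by \<open>k\<close> has the eigenvalues \<open>1, a, y, z\<close>, where
  \<open>y = (n a\<^sup>2 - 1) / (n - 1)\<close>, of multiplicities \<open>1, n, m2, m3\<close> with \<open>m2 = (n - 1) (n + 2) / 2 > n\<close>.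
  All traces of its powers are rational, so an irrational \<open>a\<close> has a conjugate of the same
  multiplicity among \<open>y, z\<close>; it must be \<open>z\<close>, which forces \<open>m3 = n\<close>, \<open>z = - a\<close> and \<open>a\<^sup>2 = 1 / (n + 2)\<close>.
  The first and third moments then show that the inner products are \<open>a, - a, - 1\<close>, and counting
  points gives \<open>n = 3\<close> and 12 points. Three of these at mutual inner product \<open>1 / sqrt 5\<close> determine
  all the others, as a face determines an icosahedron.
\<close>


section \<open>Invariance of Lebesgue measure and surface measure under orthogonal maps\<close>

lemma nn_integral_lborel_translate:
  fixes f :: "'a::euclidean_space \<Rightarrow> ennreal"
  assumes [measurable]: "f \<in> borel_measurable borel"
  shows "(\<integral>\<^sup>+x. f (x + c) \<partial>lborel) = (\<integral>\<^sup>+x. f x \<partial>lborel)"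
proof -
  have "(\<integral>\<^sup>+x. f x \<partial>lborel) = (\<integral>\<^sup>+x. f x \<partial>(distr lborel borel ((+) c)))"
    by (simp add: lborel_distr_plus)
  also have "\<dots> = (\<integral>\<^sup>+x. f (x + c) \<partial>lborel)"
    by (subst nn_integral_distr) (simp_all add: add.commute)
  finally show ?thesis by simp
qed

lemma emeasure_lborel_vimage_isometry:
  fixes T :: "'a::euclidean_space \<Rightarrow> 'a"
  assumes T: "orthogonal_transformation T" and A[measurable]: "A \<in> sets borel"
  shows "emeasure lborel (T -` A) = emeasure lborel A"
proof -
  interpret linear T
    using T by (rule orthogonal_transformation_linear)
  have Tm[measurable]: "T \<in> borel_measurable borel"
    using T by (intro borel_measurable_continuous_onI linear_continuous_on linear_linear[THEN iffD1])
       (auto intro: orthogonal_transformation_linear simp: linear_linear linear_axioms)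
  have nT: "norm (T x) = norm x" for x
    using T by (simp add: orthogonal_transformation)
  have bij: "bij T"
    using T by (rule orthogonal_transformation_bij)
  define B :: "'a set" where "B = ball 0 1"
  have [measurable]: "B \<in> sets borel" by (simp add: B_def)
  have [measurable]: "T -` A \<in> sets borel"
    using measurable_sets[OF Tm A] by simp
  txt \<open>Fubini, with the unit ball \<open>B\<close> as an isometry-invariant test set, moves \<open>T\<close> off \<open>A\<close>.\<close>
  have "emeasure lborel (T -` A) * emeasure lborel B
      = (\<integral>\<^sup>+x. indicator A (T x) * emeasure lborel B \<partial>lborel)"
    by (simp add: nn_integral_multc flip: indicator_vimage)
  also have "\<dots> = (\<integral>\<^sup>+x. \<integral>\<^sup>+y. indicator A (T x) * indicator B (y - T x) \<partial>lborel \<partial>lborel)"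
  proof (rule nn_integral_cong)
    fix x
    have "(\<integral>\<^sup>+y. indicator A (T x) * indicator B (y - T x) \<partial>lborel)
        = indicator A (T x) * (\<integral>\<^sup>+y. indicator B (y + (- T x)) \<partial>lborel)"
      by (subst nn_integral_cmult) auto
    also have "\<dots> = indicator A (T x) * emeasure lborel B"
      by (subst nn_integral_lborel_translate) auto
    finally show "indicator A (T x) * emeasure lborel B =
        (\<integral>\<^sup>+y. indicator A (T x) * indicator B (y - T x) \<partial>lborel)" by simp
  qed
  also have "\<dots> = (\<integral>\<^sup>+y. \<integral>\<^sup>+x. indicator A (T x) * indicator B (y - T x) \<partial>lborel \<partial>lborel)"
    by (rule lborel_pair.Fubini') measurable
  also have "\<dots> = (\<integral>\<^sup>+y. \<integral>\<^sup>+x. indicator A (T x + y) * indicator B x \<partial>lborel \<partial>lborel)"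
  proof (rule nn_integral_cong)
    fix y
    obtain s where s: "y = T s" using bij by (metis bij_pointE)
    have "(\<integral>\<^sup>+x. indicator A (T x) * indicator B (y - T x) \<partial>lborel)
       = (\<integral>\<^sup>+x. indicator A (T (x + s)) * indicator B (y - T (x + s)) \<partial>lborel)"
      by (rule nn_integral_lborel_translate[symmetric]) measurable
    \<comment> \<open>Here \<open>y - T (x + s)\<close> equals \<open>- T x\<close>; the ball is
      symmetric and \<open>T\<close> preserves norms, so membership in \<open>B\<close> depends on
      \<open>x\<close> alone.\<close>
    also have "\<dots> = (\<integral>\<^sup>+x. indicator A (T x + y) * indicator B x \<partial>lborel)"
      by (rule nn_integral_cong) (auto simp: s add B_def nT indicator_def)
    finally show "(\<integral>\<^sup>+x. indicator A (T x) * indicator B (y - T x) \<partial>lborel) = \<dots>" .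
  qed
  also have "\<dots> = (\<integral>\<^sup>+x. \<integral>\<^sup>+y. indicator A (T x + y) * indicator B x \<partial>lborel \<partial>lborel)"
    by (rule lborel_pair.Fubini') measurable
  also have "\<dots> = (\<integral>\<^sup>+x. emeasure lborel A * indicator B x \<partial>lborel)"
  proof (rule nn_integral_cong)
    fix x
    have "(\<integral>\<^sup>+y. indicator A (T x + y) * indicator B x \<partial>lborel)
        = (\<integral>\<^sup>+y. indicator A (y + T x) \<partial>lborel) * indicator B x"
      by (subst nn_integral_multc) (auto simp: add.commute)
    also have "\<dots> = emeasure lborel A * indicator B x"
      by (subst nn_integral_lborel_translate) auto
    finally show "(\<integral>\<^sup>+y. indicator A (T x + y) * indicator B x \<partial>lborel) = \<dots>" .
  qed
  also have "\<dots> = emeasure lborel A * emeasure lborel B"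
    by (simp add: nn_integral_cmult)
  finally have "emeasure lborel (T -` A) * emeasure lborel B = emeasure lborel A * emeasure lborel B" .
  moreover have "emeasure lborel B \<noteq> 0" "emeasure lborel B \<noteq> \<infinity>"
    unfolding B_def by (simp_all add: emeasure_ball less_imp_neq[OF unit_ball_vol_pos, symmetric])
  ultimately show ?thesis
    by (simp add: mult.commute[of _ "emeasure lborel B"] ennreal_mult_cancel_left)
qed

text \<open>A linear norm-preserving map commutes with forming the cone over a subset of the sphere,
  so the invariance of Lebesgue measure passes to the surface measure.\<close>

lemma integral_surface_measure_isometry:
  fixes T :: "'a::euclidean_space \<Rightarrow> 'a"
  assumes T: "orthogonal_transformation T" and f: "f \<in> borel_measurable borel"
  shows "(LINT x|surface_measure. f (T x)) = (LINT x|surface_measure. (f x :: real))"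
proof -
  let ?S = "surface_measure :: 'a measure"
  interpret linear T
    using T by (rule orthogonal_transformation_linear)
  have Tm[measurable]: "T \<in> borel_measurable borel"
    using T by (intro borel_measurable_continuous_onI linear_continuous_on linear_linear[THEN iffD1])
       (auto intro: orthogonal_transformation_linear simp: linear_linear linear_axioms)
  have nT: "norm (T x) = norm x" for x
    using T by (simp add: orthogonal_transformation)
  have sets: "sets ?S = sets (restrict_space borel (sphere 0 1))"
    by (simp add: surface_measure_def)
  have TS: "T \<in> measurable ?S ?S"
    unfolding measurable_cong_sets[OF sets sets]
    by (intro measurable_restrict_space2 measurable_restrict_space1)
      (auto simp: space_restrict_space nT)
  have inv: "distr ?S ?S T = ?S"
  proof (rule measure_eqI)
    fix A assume "A \<in> sets (distr ?S ?S T)"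
    then have A: "A \<in> sets borel" "A \<subseteq> sphere 0 1"
      by (auto simp: sets sets_restrict_space_iff)
    have AS: "A \<in> sets ?S" using A by (simp add: sets sets_restrict_space_iff)
    define R where "R A = {r *\<^sub>R x | r x. 0 < r \<and> r \<le> 1 \<and> x \<in> A}" for A :: "'a set"
    \<comment> \<open>Writing the cone as a preimage under radial projection gives its measurability
      and its behaviour under \<open>T\<close>.\<close>
    have R: "R A = (\<lambda>x. x /\<^sub>R norm x) -` A \<inter> (cball 0 1 - {0})" if "A \<subseteq> sphere 0 1" for A
    proof (intro equalityI subsetI)
      fix y assume y: "y \<in> (\<lambda>x. x /\<^sub>R norm x) -` A \<inter> (cball 0 1 - {0})"
      then have "y = norm y *\<^sub>R (y /\<^sub>R norm y)" "0 < norm y" "norm y \<le> 1" by auto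
      with y show "y \<in> R A" unfolding R_def by blast
    next
      fix y assume "y \<in> R A"
      then obtain r x where "y = r *\<^sub>R x" "0 < r" "r \<le> 1" "x \<in> A" unfolding R_def by blast
      moreover from this have "norm x = 1" using that by auto
      ultimately show "y \<in> (\<lambda>x. x /\<^sub>R norm x) -` A \<inter> (cball 0 1 - {0})" by auto
    qed
    have RA: "R A \<in> sets borel"
    proof -
      have "(\<lambda>x::'a. x /\<^sub>R norm x) -` A \<inter> space borel \<in> sets borel"
        by (rule measurable_sets[OF _ A(1)]) simp
      then show ?thesis using A by (subst R) auto
    qed
    have A': "T -` A \<in> sets borel" "T -` A \<subseteq> sphere 0 1"
      using measurable_sets[OF Tm A(1)] A(2) nT by auto
    have nz: "T x = 0 \<longleftrightarrow> x = 0" for x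
      using nT[of x] by auto
    have "R (T -` A) = T -` R A"
      by (auto simp: R[OF A(2)] R[OF A'(2)] nT scale nz)
    then have "emeasure ?S (T -` A) = emeasure ?S A"
      using emeasure_lborel_vimage_isometry[OF T RA]
      unfolding emeasure_surface_measure[OF A] emeasure_surface_measure[OF A'] R_def[symmetric]
      by simp
    moreover have "T -` A \<inter> space ?S = T -` A"
      using A' by (auto simp: space_surface_measure)
    ultimately show "emeasure (distr ?S ?S T) A = emeasure ?S A"
      by (simp add: emeasure_distr[OF TS AS])
  qed simp
  have fS: "f \<in> borel_measurable ?S"
    unfolding measurable_cong_sets[OF sets refl] by (rule measurable_restrict_space1[OF f])
  have "(LINT x|?S. f (T x)) = (LINT x|distr ?S ?S T. f x)"
    by (rule integral_distr[OF TS fS, symmetric])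
  then show ?thesis by (simp add: inv)
qed

section \<open>Powers of linear forms as polynomials, and power sums over a design\<close>

definition monom_fun :: "('n \<Rightarrow> nat) \<Rightarrow> real^'n \<Rightarrow> real" where
  "monom_fun \<alpha> x = (\<Prod>i\<in>UNIV. (x $ i) ^ \<alpha> i)"

lemma polynomial_deg_le_monom:
  fixes \<alpha> :: "'n::finite \<Rightarrow> nat"
  assumes "sum \<alpha> UNIV \<le> t"
  shows "polynomial_deg_le t (monom_fun \<alpha>)"
  unfolding polynomial_deg_le_def
proof (intro exI[of _ "\<lambda>\<beta>. if \<beta> = \<alpha> then 1 else 0"] allI)
  fix x :: "real^'n"
  have "(\<Sum>\<beta> :: 'n \<Rightarrow> nat | sum \<beta> UNIV \<le> t. (if \<beta> = \<alpha> then 1 else 0) * (\<Prod>i\<in>UNIV. (x $ i) ^ \<beta> i))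
     = (\<Sum>\<beta> | sum \<beta> UNIV \<le> t. if \<beta> = \<alpha> then (\<Prod>i\<in>UNIV. (x $ i) ^ \<beta> i) else 0)"
    by (rule sum.cong) auto
  also have "\<dots> = monom_fun \<alpha> x"
    using assms by (subst sum.delta[OF finite_multi_indices]) (simp add: monom_fun_def)
  finally show "monom_fun \<alpha> x =
    (\<Sum>\<beta> | sum \<beta> UNIV \<le> t. (if \<beta> = \<alpha> then 1 else 0) * (\<Prod>i\<in>UNIV. (x $ i) ^ \<beta> i))" by simp
qed

lemma polynomial_deg_le_sum:
  assumes "\<And>i. i \<in> S \<Longrightarrow> polynomial_deg_le t (f i)"
  shows "polynomial_deg_le t (\<lambda>x. \<Sum>i\<in>S. f i x)"
proof -
  obtain c where c: "\<And>i x. i \<in> S \<Longrightarrow>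
     f i x = (\<Sum>\<alpha> | sum \<alpha> UNIV \<le> t. c i \<alpha> * (\<Prod>j\<in>UNIV. (x $ j) ^ \<alpha> j))"
    using assms unfolding polynomial_deg_le_def by metis
  show ?thesis
    unfolding polynomial_deg_le_def
  proof (intro exI[of _ "\<lambda>\<alpha>. \<Sum>i\<in>S. c i \<alpha>"] allI)
    fix x
    show "(\<Sum>i\<in>S. f i x) = (\<Sum>\<alpha> | sum \<alpha> UNIV \<le> t. (\<Sum>i\<in>S. c i \<alpha>) * (\<Prod>j\<in>UNIV. (x $ j) ^ \<alpha> j))"
      by (simp add: c sum_distrib_right sum.swap[of _ S])
  qed
qed

lemma polynomial_deg_le_scale:
  assumes "polynomial_deg_le t f"
  shows "polynomial_deg_le t (\<lambda>x. a * f x)"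
proof -
  obtain c where "\<forall>x. f x = (\<Sum>\<alpha> | sum \<alpha> UNIV \<le> t. c \<alpha> * (\<Prod>j\<in>UNIV. (x $ j) ^ \<alpha> j))"
    using assms unfolding polynomial_deg_le_def by metis
  then show ?thesis
    unfolding polynomial_deg_le_def
    by (intro exI[of _ "\<lambda>\<alpha>. a * c \<alpha>"]) (simp add: sum_distrib_left mult.assoc)
qed

lemma polynomial_deg_le_mult:
  assumes "polynomial_deg_le s f" "polynomial_deg_le t g"
  shows "polynomial_deg_le (s + t) (\<lambda>x. f x * g x)"
proof -
  obtain c where c: "\<And>x. f x = (\<Sum>\<alpha> | sum \<alpha> UNIV \<le> s. c \<alpha> * monom_fun \<alpha> x)"
    using assms unfolding polynomial_deg_le_def monom_fun_def by metis
  obtain d where d: "\<And>x. g x = (\<Sum>\<alpha> | sum \<alpha> UNIV \<le> t. d \<alpha> * monom_fun \<alpha> x)"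
    using assms unfolding polynomial_deg_le_def monom_fun_def by metis
  have eq: "(\<lambda>x. f x * g x) = (\<lambda>x. \<Sum>\<alpha> | sum \<alpha> UNIV \<le> s. \<Sum>\<beta> | sum \<beta> UNIV \<le> t.
      c \<alpha> * d \<beta> * monom_fun (\<lambda>i. \<alpha> i + \<beta> i) x)"
    by (simp add: c d sum_product monom_fun_def power_add prod.distrib mult_ac)
  show ?thesis
    unfolding eq
    by (intro polynomial_deg_le_sum polynomial_deg_le_scale polynomial_deg_le_monom)
      (simp add: sum.distrib add_mono)
qed

lemma polynomial_deg_le_inner_power: "polynomial_deg_le k (\<lambda>x. (u \<bullet> x) ^ k)"
proof (induction k)
  case 0
  have "(\<lambda>x. (u \<bullet> x) ^ 0) = monom_fun (\<lambda>_. 0)"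
    by (auto simp: monom_fun_def)
  then show ?case by (simp add: polynomial_deg_le_monom)
next
  case (Suc k)
  have eq: "(\<lambda>x. u \<bullet> x) = (\<lambda>x. \<Sum>i\<in>UNIV. u $ i * monom_fun (\<lambda>j. if j = i then 1 else 0) x)"
    by (simp add: fun_eq_iff monom_fun_def inner_vec_def if_distrib[of "\<lambda>n. _ ^ n"] cong: if_cong)
  have "polynomial_deg_le 1 (\<lambda>x. u \<bullet> x)"
    unfolding eq
    by (intro polynomial_deg_le_sum polynomial_deg_le_scale polynomial_deg_le_monom) simp
  then show ?case using polynomial_deg_le_mult[OF _ Suc] by fastforce
qed

lemma polynomial_deg_le_mono:
  assumes "polynomial_deg_le s f" "s \<le> t"
  shows "polynomial_deg_le t f"
proof -
  obtain c where c: "\<And>x. f x = (\<Sum>\<alpha> | sum \<alpha> UNIV \<le> s. c \<alpha> * monom_fun \<alpha> x)"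
    using assms unfolding polynomial_deg_le_def monom_fun_def by metis
  have eq: "f = (\<lambda>x. \<Sum>\<alpha> | sum \<alpha> UNIV \<le> s. c \<alpha> * monom_fun \<alpha> x)"
    by (simp add: c fun_eq_iff)
  show ?thesis
    unfolding eq using \<open>s \<le> t\<close>
    by (intro polynomial_deg_le_sum polynomial_deg_le_scale polynomial_deg_le_monom) simp
qed

text \<open>An orthogonal map carrying \<open>v\<close> to \<open>u\<close> preserves the surface
  measure, so both powers have the same integral, and the design property transfers this to the
  sums. Neither integral is evaluated; the constants come later from finite sums over a
  basis.\<close>

lemma spherical_design_power_sum_eq:
  fixes u v :: "real^'n"
  assumes C: "spherical_design t C" and "k \<le> t" and uv: "norm u = norm v"
  shows "(\<Sum>w\<in>C. (u \<bullet> w) ^ k) = (\<Sum>w\<in>C. (v \<bullet> w) ^ k)"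
proof (cases "C = {}")
  case False
  obtain T where T: "orthogonal_transformation T" "T v = u"
    using orthogonal_transformation_exists[of v u] uv by metis
  have "(LINT x|surface_measure. (v \<bullet> x) ^ k) = (LINT x|surface_measure. (u \<bullet> T x) ^ k)"
    using T by (intro Bochner_Integration.integral_cong) (auto simp: orthogonal_transformation_def)
  also have "\<dots> = (LINT x|surface_measure. (u \<bullet> x) ^ k)"
    by (rule integral_surface_measure_isometry[OF T(1)]) simp
  finally have eq: "(LINT x|surface_measure. (v \<bullet> x) ^ k) = \<dots>" .
  have "polynomial_deg_le t (\<lambda>x. (u \<bullet> x) ^ k)" for u :: "real^'n"
    using polynomial_deg_le_mono[OF polynomial_deg_le_inner_power \<open>k \<le> t\<close>] .
  then have "1 / card C * (\<Sum>x\<in>C. (u \<bullet> x) ^ k) = 1 / card C * (\<Sum>x\<in>C. (v \<bullet> x) ^ k)"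
    using C eq unfolding spherical_design_def by metis
  moreover have "card C \<noteq> 0"
    using C False by (auto simp: spherical_design_def)
  ultimately show ?thesis by simp
qed simp


section \<open>Arithmetic of rational power sums\<close>

text \<open>Linear independence of \<open>1\<close> and an irrational \<open>x\<close> over the
  rationals, used below to compare coefficients.\<close>

lemma Rats_affine_irrational:
  fixes x :: real
  assumes "p \<in> \<rat>" "p * x + q \<in> \<rat>" "q \<in> \<rat>" "x \<notin> \<rat>"
  shows "p = 0"
proof (rule ccontr)
  assume p: "p \<noteq> 0"
  have "((p * x + q) - q) / p \<in> \<rat>" using assms by (intro Rats_divide Rats_diff) auto
  also have "((p * x + q) - q) / p = x" using p by simp
  finally show False using assms by simp
qed

text \<open>The sums satisfy a two-term recurrence with coefficients \<open>x + y\<close> and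
  \<open>- x * y\<close>. Cramer's rule solves for these; its determinant \<open>D\<close> is
  nonzero because the nodes are distinct and the weights nonzero.\<close>

lemma two_node_power_sums_rational:
  fixes x y w1 w2 :: real
  assumes "w1 \<noteq> 0" "w2 \<noteq> 0" "x \<noteq> y"
    and S: "\<And>j::nat. w1 * x ^ j + w2 * y ^ j \<in> \<rat>"
  shows "x + y \<in> \<rat>" "x * y \<in> \<rat>"
proof -
  define S where "S j = w1 * x ^ j + w2 * y ^ j" for j :: nat
  have SQ: "S j \<in> \<rat>" for j using S by (simp add: S_def)
  define D where "D = S 0 * S 2 - S 1 * S 1"
  have D: "D = w1 * w2 * (x - y)^2"
    unfolding D_def S_def by (simp add: algebra_simps power2_eq_square)
  then have D0: "D \<noteq> 0" using assms by simp
  have DQ: "D \<in> \<rat>" unfolding D_def by (intro Rats_diff Rats_mult SQ)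
  have "(S 0 * S 3 - S 1 * S 2) / D = x + y"
    using D0 by (simp add: field_simps) (simp add: D S_def, algebra)
  then show "x + y \<in> \<rat>"
    by (metis Rats_diff Rats_divide Rats_mult SQ DQ)
  have "(S 1 * S 3 - S 2 * S 2) / D = x * y"
    using D0 by (simp add: field_simps) (simp add: D S_def, algebra)
  then show "x * y \<in> \<rat>"
    by (metis Rats_diff Rats_divide Rats_mult SQ DQ)
qed

text \<open>
  Cramer's rule for the Hankel system satisfied by the elementary symmetric functions of the nodes.
\<close>

lemma three_node_power_sums_rational:
  fixes x y z w1 w2 w3 :: real
  assumes w: "w1 \<noteq> 0" "w2 \<noteq> 0" "w3 \<noteq> 0" and d: "x \<noteq> y" "x \<noteq> z" "y \<noteq> z"
    and S: "\<And>j::nat. w1 * x ^ j + w2 * y ^ j + w3 * z ^ j \<in> \<rat>"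
  shows "x + y + z \<in> \<rat>" "x * y + x * z + y * z \<in> \<rat>" "x * y * z \<in> \<rat>"
proof -
  define S where "S j = w1 * x ^ j + w2 * y ^ j + w3 * z ^ j" for j :: nat
  have SQ: "S j \<in> \<rat>" for j using S by (simp add: S_def)
  define det where "det a1 a2 a3 b1 b2 b3 c1 c2 c3 =
      a1 * (b2 * c3 - b3 * c2) - a2 * (b1 * c3 - b3 * c1) + a3 * (b1 * c2 - b2 * c1)"
    for a1 a2 a3 b1 b2 b3 c1 c2 c3 :: real
  have detQ: "det a1 a2 a3 b1 b2 b3 c1 c2 c3 \<in> \<rat>"
    if "a1 \<in> \<rat>" "a2 \<in> \<rat>" "a3 \<in> \<rat>" "b1 \<in> \<rat>" "b2 \<in> \<rat>" "b3 \<in> \<rat>" "c1 \<in> \<rat>" "c2 \<in> \<rat>" "c3 \<in> \<rat>"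
    for a1 a2 a3 b1 b2 b3 c1 c2 c3
    unfolding det_def using that by (intro Rats_add Rats_diff Rats_mult)
  define D where "D = det (S 0) (S 1) (S 2) (S 1) (S 2) (S 3) (S 2) (S 3) (S 4)"
  \<comment> \<open>The Hankel determinant is the product of the weights and the squared Vandermonde
    determinant.\<close>
  have D: "D = w1 * w2 * w3 * ((x - y) * (x - z) * (y - z))^2"
    unfolding D_def S_def det_def by algebra
  then have D0: "D \<noteq> 0" using w d by simp
  have DQ: "D \<in> \<rat>" unfolding D_def by (intro detQ SQ)
  define e1 e2 e3 where "e1 = x + y + z" and "e2 = x * y + x * z + y * z" and "e3 = x * y * z"
  \<comment> \<open>The unknowns of the linear system are \<open>e3\<close>, \<open>- e2\<close>,
    \<open>e1\<close>, in this column order; hence the minus sign in the formula for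
    \<open>e2\<close>.\<close>
  have rec: "S (j + 3) = e1 * S (j + 2) - e2 * S (j + 1) + e3 * S j" for j
    unfolding S_def e1_def e2_def e3_def power_add by algebra
  have r: "S 3 = e1 * S 2 - e2 * S 1 + e3 * S 0" "S 4 = e1 * S 3 - e2 * S 2 + e3 * S 1"
    "S 5 = e1 * S 4 - e2 * S 3 + e3 * S 2"
    using rec[of 0] rec[of 1] rec[of 2] by (simp_all add: numeral_eq_Suc)
  have "D * e1 = det (S 0) (S 1) (S 3) (S 1) (S 2) (S 4) (S 2) (S 3) (S 5)"
    unfolding D_def det_def using r by algebra
  then have "e1 = det (S 0) (S 1) (S 3) (S 1) (S 2) (S 4) (S 2) (S 3) (S 5) / D"
    using D0 by (simp add: field_simps)
  then show "x + y + z \<in> \<rat>"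
    unfolding e1_def[symmetric] by (simp only:) (intro Rats_divide detQ SQ DQ)
  have "D * e2 = - det (S 0) (S 3) (S 2) (S 1) (S 4) (S 3) (S 2) (S 5) (S 4)"
    unfolding D_def det_def using r by algebra
  then have "e2 = - det (S 0) (S 3) (S 2) (S 1) (S 4) (S 3) (S 2) (S 5) (S 4) / D"
    using D0 by (simp add: field_simps)
  then show "x * y + x * z + y * z \<in> \<rat>"
    unfolding e2_def[symmetric] by (simp only: Rats_minus_iff) (intro Rats_divide detQ SQ DQ Rats_minus_iff[THEN iffD2])
  have "D * e3 = det (S 3) (S 1) (S 2) (S 4) (S 2) (S 3) (S 5) (S 3) (S 4)"
    unfolding D_def det_def using r by algebra
  then have "e3 = det (S 3) (S 1) (S 2) (S 4) (S 2) (S 3) (S 5) (S 3) (S 4) / D"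
    using D0 by (simp add: field_simps)
  then show "x * y * z \<in> \<rat>"
    unfolding e3_def[symmetric] by (simp only:) (intro Rats_divide detQ SQ DQ)
qed

text \<open>The conjugacy argument in abstract form: the weights are multiplicities,
  \<open>S\<close> collects the rational traces without the eigenvalue 1, and \<open>S1\<close> says
  that the adjacency matrix has trace zero.\<close>

lemma irrational_eigenvalue:
  fixes x y z n m2 m3 :: real
  assumes n: "n \<ge> 3" "n \<in> \<rat>" and m2: "m2 = (n - 1) * (n + 2) / 2"
    and m3: "m3 > 0" "m3 \<in> \<rat>" and y: "y = (n * x\<^sup>2 - 1) / (n - 1)"
    and S: "\<And>j::nat. n * x ^ j + m2 * y ^ j + m3 * z ^ j \<in> \<rat>"
    and S1: "n * x + m2 * y + m3 * z = - 1" and x: "x \<notin> \<rat>"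
  shows "m3 = n" "x\<^sup>2 = 1 / (n + 2)"
proof -
  have m2Q: "m2 \<in> \<rat>" using n unfolding m2 by (intro Rats_divide Rats_mult Rats_add Rats_diff) auto
  have "m2 - n = (n - 2) * (n + 1) / 2" unfolding m2 by (simp add: field_simps)
  moreover have "(n - 2) * (n + 1) > 0" using n by simp
  ultimately have m2n: "m2 > n" by simp
  have yx: "n * x\<^sup>2 = (n - 1) * y + 1" using n by (simp add: y field_simps)
  have xy: "x \<noteq> y"
  proof
    assume "x = y"
    then have "(x - 1) * (n * x + 1) = 0" using yx by (simp add: algebra_simps power2_eq_square)
    then have "x - 1 = 0 \<or> n * x + 1 = 0" by simp
    then have "x = 1 \<or> x = - (1 / n)" using n by (auto simp: field_simps)
    with x n show False by auto
  qed
  \<comment> \<open>If \<open>y = z\<close>, then \<open>x + y\<close> is rational, and comparing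
    coefficients of \<open>x\<close> in \<open>S1\<close> gives \<open>n = m2 + m3\<close>, against
    \<open>m2 > n\<close>.\<close>
  have yz: "y \<noteq> z"
  proof
    assume e: "y = z"
    have "x + y \<in> \<rat>"
      by (rule two_node_power_sums_rational[of n "m2 + m3"])
        (use n m2n m3 xy S e in \<open>auto simp: algebra_simps\<close>)
    moreover have "(n - (m2 + m3)) * x + (m2 + m3) * (x + y) = -1"
      using S1 e by (simp add: algebra_simps)
    ultimately have "n - (m2 + m3) = 0"
      using n m2Q m3 x by (intro Rats_affine_irrational[of _ x "(m2 + m3) * (x + y)"]) auto
    with m2n m3 show False by simp
  qed
  \<comment> \<open>If \<open>x = z\<close>, the trace relation forces \<open>n + m3 = m2\<close>.
    The quadratic relation between \<open>x\<close> and \<open>y\<close> then yields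
    \<open>m2 * (n - 1) = n\<close>, again against \<open>m2 > n\<close>.\<close>
  have xz: "x \<noteq> z"
  proof
    assume e: "x = z"
    have ww: "n + m3 \<noteq> 0" "m2 \<noteq> 0" using n m2n m3 by auto
    have SS: "(n + m3) * x ^ j + m2 * y ^ j \<in> \<rat>" for j :: nat
      using S[of j] e by (simp add: algebra_simps)
    have q: "x + y \<in> \<rat>" "x * y \<in> \<rat>"
      using two_node_power_sums_rational[OF ww xy SS] by auto
    have "((n + m3) - m2) * x + m2 * (x + y) = -1"
      using S1 e by (simp add: algebra_simps)
    then have w: "n + m3 = m2"
      using q n m2Q m3 x Rats_affine_irrational[of "(n + m3) - m2" x "m2 * (x + y)"] by auto
    have s: "m2 * (x + y) = -1" using S1 e unfolding w[symmetric] by (simp add: algebra_simps)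
    have "n * x\<^sup>2 + (n - 1) * x = (n - 1) * (x + y) + 1" using yx by (simp add: algebra_simps)
    moreover have "n * x\<^sup>2 = n * x * (x + y) - n * (x * y)" by (simp add: algebra_simps power2_eq_square)
    ultimately have "(n * (x + y) + (n - 1)) * x + (- n * (x * y)) = (n - 1) * (x + y) + 1"
      by (simp add: algebra_simps)
    then have "n * (x + y) + (n - 1) = 0"
      using q n x by (intro Rats_affine_irrational[of _ x "- n * (x * y)"]) auto
    then have "m2 * (n - 1) = n" using s by algebra
    moreover have "m2 * (n - 1) > n * 1"
      using m2n n by (intro mult_strict_mono) auto
    ultimately show False by simp
  qed
  have m0: "n \<noteq> 0" "m2 \<noteq> 0" "m3 \<noteq> 0" using n m2n m3 by auto
  note Q = three_node_power_sums_rational[OF m0 xy xz yz S]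
  have "(n - m3) * x + (m2 - m3) * y = -1 - m3 * (x + y + z)"
    using S1 by (simp add: algebra_simps)
  then have "(n - m3) * x + (m2 - m3) * ((n * x\<^sup>2 - 1) / (n - 1)) = -1 - m3 * (x + y + z)"
    by (simp add: y)
  \<comment> \<open>Eliminating \<open>y\<close> from the trace relation leaves a quadratic equation
    for \<open>x\<close> over the rationals, which is proper once \<open>m2 \<noteq> m3\<close> is
    known.\<close>
  then have quad: "(m2 - m3) * n * x\<^sup>2 =
      (m2 - m3) - (n - 1) * (1 + m3 * (x + y + z)) - (n - m3) * (n - 1) * x"
    using n by (simp add: field_simps)
  have "m2 \<noteq> m3"
  proof
    assume "m2 = m3"
    then have "((n - m3) * (n - 1)) * x + (n - 1) * (1 + m3 * (x + y + z)) \<in> \<rat>"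
      using quad by (simp add: algebra_simps)
    then have "(n - m3) * (n - 1) = 0"
      using n m3 Q x by (intro Rats_affine_irrational[of _ x "(n - 1) * (1 + m3 * (x + y + z))"]) auto
    with \<open>m2 = m3\<close> n m2n show False by simp
  qed
  define s r where "s = - (n - m3) * (n - 1) / ((m2 - m3) * n)"
    and "r = ((m2 - m3) - (n - 1) * (1 + m3 * (x + y + z))) / ((m2 - m3) * n)"
  have xx: "x\<^sup>2 = s * x + r"
  proof -
    have "(m2 - m3) * n \<noteq> 0" using \<open>m2 \<noteq> m3\<close> n by simp
    moreover have "(m2 - m3) * n * x\<^sup>2 = (m2 - m3) * n * (s * x + r)"
    proof -
      have "(m2 - m3) * n * s = - (n - m3) * (n - 1)"
        "(m2 - m3) * n * r = (m2 - m3) - (n - 1) * (1 + m3 * (x + y + z))"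
        using \<open>m2 \<noteq> m3\<close> n by (simp_all add: s_def r_def)
      with quad show ?thesis by algebra
    qed
    ultimately show ?thesis using mult_left_cancel by blast
  qed
  have srQ: "s \<in> \<rat>" "r \<in> \<rat>"
    unfolding s_def r_def using n m2Q m3 Q
    by (auto intro!: Rats_divide Rats_mult Rats_diff Rats_add)
  define e1 e2 e3 where "e1 = x + y + z" and "e2 = x * y + x * z + y * z" and "e3 = x * y * z"
  have eQ: "e1 \<in> \<rat>" "e2 \<in> \<rat>" "e3 \<in> \<rat>" using Q by (simp_all add: e1_def e2_def e3_def)
  \<comment> \<open>The rational cubic with roots \<open>x, y, z\<close> is reduced modulo
    \<open>t\<^sup>2 - s * t - r\<close> to \<open>A * t + B\<close>. Irrationality of
    \<open>x\<close> kills this remainder, so the conjugate \<open>s - x\<close> is a root as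
    well.\<close>
  define p where "p t = (t - x) * (t - y) * (t - z)" for t
  have p: "p t = t^3 - e1 * t\<^sup>2 + e2 * t - e3" for t
    unfolding p_def e1_def e2_def e3_def by algebra
  define A B where "A = s * s + r - e1 * s + e2" and "B = s * r - e1 * r - e3"
  have pAB: "p t = A * t + B" if "t\<^sup>2 = s * t + r" for t
    unfolding p A_def B_def using that by algebra
  have "A * x + B = 0" using pAB[OF xx] by (simp add: p_def)
  moreover have "A \<in> \<rat>" "B \<in> \<rat>"
    unfolding A_def B_def using srQ eQ by (auto intro!: Rats_mult Rats_diff Rats_add)
  ultimately have "A = 0" using x by (intro Rats_affine_irrational[of _ x B]) auto
  with \<open>A * x + B = 0\<close> have "B = 0" by simp
  have "p (s - x) = 0"
    using \<open>A = 0\<close> \<open>B = 0\<close> xx by (subst pAB) (simp_all add: power2_eq_square algebra_simps)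
  moreover have "s - x \<noteq> x"
  proof
    assume "s - x = x"
    then have "x = s / 2" by simp
    with srQ x show False by simp
  qed
  ultimately consider "s - x = y" | "s - x = z" unfolding p_def by auto
  then have z: "s - x = z"
  proof cases
    \<comment> \<open>A conjugate pair \<open>x, y\<close> would need equal weights, that is
      \<open>n = m2\<close>, so this case is contradictory.\<close>
    case 1
    then have "z \<in> \<rat>" using eQ srQ unfolding e1_def by (metis Rats_diff add_diff_cancel_left' diff_add_cancel add.commute)
    moreover have "(n - m2) * x + (m2 * s + m3 * z) = -1"
      using S1 1 by (auto simp: algebra_simps)
    ultimately have "n - m2 = 0"
      using n m2Q m3 x srQ by (intro Rats_affine_irrational[of _ x "m2 * s + m3 * z"]) auto
    then show ?thesis using m2n by simp
  qed
  have yQ: "y \<in> \<rat>"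
  proof -
    have "y = e1 - s" using z by (simp add: e1_def)
    then show ?thesis using eQ srQ by simp
  qed
  have "(n - m3) * x + (m2 * y + m3 * s) = -1"
    using S1 z by (auto simp: algebra_simps)
  then have "n - m3 = 0"
    using n m2Q m3 x srQ yQ by (intro Rats_affine_irrational[of _ x "m2 * y + m3 * s"]) auto
  then show m3n: "m3 = n" by simp
  have "x\<^sup>2 = ((n - 1) * y + 1) / n" using yx n by (simp add: field_simps)
  then have "x\<^sup>2 \<in> \<rat>" using n yQ by simp
  \<comment> \<open>With \<open>x\<^sup>2\<close> rational, the conjugate of \<open>x\<close> is
    \<open>- x\<close>.\<close>
  then have "s = 0" using srQ x xx by (intro Rats_affine_irrational[of _ x r]) auto
  then have "z = - x" using z by simp
  then have "m2 * y = -1" using S1 m3n by simp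
  moreover have "2 * (m2 * y) = (n + 2) * (n * x\<^sup>2 - 1)" 
  proof -
    have "2 * (m2 * y) = (n + 2) * ((n - 1) * y)" by (simp add: m2)
    with yx show ?thesis by simp
  qed
  ultimately have "(n + 2) * (n * x\<^sup>2 - 1) = -2" by simp
  then have "n * ((n + 2) * x\<^sup>2) = n * 1" by (simp add: algebra_simps)
  then have "(n + 2) * x\<^sup>2 = 1" using n by simp
  then show "x\<^sup>2 = 1 / (n + 2)" using n by (simp add: field_simps)
qed


section \<open>Moments of a spherical 4-design\<close>

lemma sum_Basis_inner_squared:
  fixes w :: "'a::euclidean_space"
  shows "(\<Sum>b\<in>Basis. (b \<bullet> w)\<^sup>2) = (norm w)\<^sup>2" "(\<Sum>b\<in>Basis. (w \<bullet> b)\<^sup>2) = (norm w)\<^sup>2"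
  unfolding power2_norm_eq_inner euclidean_inner[of w w] by (simp_all add: power2_eq_square inner_commute)

locale spherical_4_design =
  fixes C :: "(real^'n) set"
  assumes design: "spherical_design 4 C" and dim: "CARD('n) \<ge> 3" and nonempty: "C \<noteq> {}"
begin

definition n :: real where "n = real CARD('n)"
definition N :: real where "N = real (card C)"

lemma n_ge: "n \<ge> 3"
  using dim by (simp add: n_def)

lemma finC: "finite C"
  using design by (simp add: spherical_design_def)

lemma N_pos: "N > 0"
  using finC nonempty by (simp add: N_def card_gt_0_iff)

lemma normC [simp]: "u \<in> C \<Longrightarrow> norm u = 1"
  using design by (auto simp: spherical_design_def)

lemma innerC [simp]: "u \<in> C \<Longrightarrow> u \<bullet> u = 1"
  by (simp add: dot_square_norm)

lemma inner_eq_1_iff: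
  assumes "u \<in> C" "v \<in> C"
  shows "u \<bullet> v = 1 \<longleftrightarrow> u = v"
proof
  assume "u \<bullet> v = 1"
  then have "(u - v) \<bullet> (u - v) = 0"
    using assms by (simp add: inner_diff_left inner_diff_right inner_commute)
  then show "u = v" by simp
qed (use assms in simp)

lemma DIM_eq: "real (card (Basis :: (real^'n) set)) = n"
  by (simp add: n_def)

lemma power_sum_eq:
  assumes "k \<le> 4" "norm u = norm v"
  shows "(\<Sum>w\<in>C. (u \<bullet> w) ^ k) = (\<Sum>w\<in>C. (v \<bullet> w) ^ k)"
  using spherical_design_power_sum_eq[OF design assms] .

lemma power_sum_odd:
  assumes "k \<le> 4" "odd k"
  shows "(\<Sum>w\<in>C. (u \<bullet> w) ^ k) = 0"
proof -
  have "(\<Sum>w\<in>C. (u \<bullet> w) ^ k) = (\<Sum>w\<in>C. ((- u) \<bullet> w) ^ k)"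
    by (rule power_sum_eq) (use assms in auto)
  also have "\<dots> = - (\<Sum>w\<in>C. (u \<bullet> w) ^ k)"
    using assms by (simp add: sum_negf)
  finally show ?thesis by simp
qed

lemma power_sum_homogeneous:
  assumes "k \<le> 4" "norm e = 1"
  shows "(\<Sum>w\<in>C. (u \<bullet> w) ^ k) = norm u ^ k * (\<Sum>w\<in>C. (e \<bullet> w) ^ k)"
proof -
  have "(\<Sum>w\<in>C. (u \<bullet> w) ^ k) = (\<Sum>w\<in>C. ((norm u *\<^sub>R e) \<bullet> w) ^ k)"
    by (rule power_sum_eq) (use assms in auto)
  also have "\<dots> = norm u ^ k * (\<Sum>w\<in>C. (e \<bullet> w) ^ k)"
    by (simp add: power_mult_distrib sum_distrib_left)
  finally show ?thesis .
qed

lemma moment_1: "(\<Sum>w\<in>C. u \<bullet> w) = 0"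
  using power_sum_odd[of 1 u] by simp

text \<open>Homogeneity gives the form up to a constant; summing over an orthonormal basis
  determines the constant.\<close>

lemma power_sum_2: "(\<Sum>w\<in>C. (u \<bullet> w)\<^sup>2) = N / n * (norm u)\<^sup>2"
proof -
  obtain e :: "real^'n" where e: "e \<in> Basis" using nonempty_Basis by blast
  define K where "K = (\<Sum>w\<in>C. (e \<bullet> w)\<^sup>2)"
  have K: "(\<Sum>w\<in>C. (u \<bullet> w)\<^sup>2) = (norm u)\<^sup>2 * K" for u
    unfolding K_def by (rule power_sum_homogeneous) (use e in auto)
  have "n * K = (\<Sum>b\<in>Basis. \<Sum>w\<in>C. (b \<bullet> w)\<^sup>2)"
    by (simp add: K DIM_eq n_def)
  also have "\<dots> = (\<Sum>w\<in>C. \<Sum>b\<in>Basis. (b \<bullet> w)\<^sup>2)"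
    by (rule sum.swap)
  also have "\<dots> = N"
    by (simp add: sum_Basis_inner_squared N_def)
  finally have "K = N / n" using n_ge by (simp add: field_simps)
  then show ?thesis by (simp add: K)
qed

lemma moment_2: "(\<Sum>w\<in>C. (u \<bullet> w) * (w \<bullet> v)) = N / n * (u \<bullet> v)"
proof -
  have "4 * (\<Sum>w\<in>C. (u \<bullet> w) * (w \<bullet> v)) = (\<Sum>w\<in>C. ((u + v) \<bullet> w)\<^sup>2) - (\<Sum>w\<in>C. ((u - v) \<bullet> w)\<^sup>2)"
    unfolding sum_subtractf[symmetric] sum_distrib_left
    by (rule sum.cong)
      (simp_all add: inner_add_left inner_diff_left inner_commute[of _ v] power2_eq_square algebra_simps)
  also have "\<dots> = N / n * ((norm (u + v))\<^sup>2 - (norm (u - v))\<^sup>2)"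
    unfolding power_sum_2 by (simp add: right_diff_distrib)
  also have "(norm (u + v))\<^sup>2 - (norm (u - v))\<^sup>2 = 4 * (u \<bullet> v)"
    by (simp add: power2_norm_eq_inner inner_add_left inner_diff_left inner_add_right
        inner_diff_right inner_commute)
  finally show ?thesis using n_ge by (simp add: field_simps)
qed

text \<open>Polarization of the vanishing odd power sums.\<close>

lemma moment_3: "(\<Sum>w\<in>C. (u \<bullet> w)\<^sup>2 * (w \<bullet> v)) = 0"
proof -
  have "6 * (\<Sum>w\<in>C. (u \<bullet> w)\<^sup>2 * (w \<bullet> v)) =
      (\<Sum>w\<in>C. ((u + v) \<bullet> w) ^ 3) - (\<Sum>w\<in>C. ((u - v) \<bullet> w) ^ 3) - 2 * (\<Sum>w\<in>C. (v \<bullet> w) ^ 3)"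
    unfolding sum_subtractf[symmetric] sum_distrib_left
    by (rule sum.cong)
      (simp_all add: inner_add_left inner_diff_left inner_commute[of _ v] power2_eq_square
        power3_eq_cube algebra_simps)
  also have "\<dots> = 0"
    by (simp add: power_sum_odd)
  finally show ?thesis by simp
qed

text \<open>Polarization of the fourth power sum gives the identity up to a factor \<open>K\<close>;
  summing over all pairs of basis vectors gives \<open>K\<close>. The 3 in the definition of
  \<open>K\<close> is the value of \<open>1 + 2 * (e \<bullet> e)\<^sup>2\<close> at a unit
  vector.\<close>

lemma moment_4:
  "(\<Sum>w\<in>C. (u \<bullet> w)\<^sup>2 * (w \<bullet> v)\<^sup>2) = N / (n * (n + 2)) * ((norm u)\<^sup>2 * (norm v)\<^sup>2 + 2 * (u \<bullet> v)\<^sup>2)"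
proof -
  obtain e :: "real^'n" where e: "e \<in> Basis" using nonempty_Basis by blast
  define K where "K = (\<Sum>w\<in>C. (e \<bullet> w) ^ 4) / 3"
  have P4: "(\<Sum>w\<in>C. (u \<bullet> w) ^ 4) = 3 * K * ((norm u)\<^sup>2)\<^sup>2" for u
    using power_sum_homogeneous[of 4 e u] e unfolding K_def
    by (simp add: mult.commute flip: power_mult)
  have B: "(\<Sum>w\<in>C. (u \<bullet> w)\<^sup>2 * (w \<bullet> v)\<^sup>2) = K * ((norm u)\<^sup>2 * (norm v)\<^sup>2 + 2 * (u \<bullet> v)\<^sup>2)" for u v
  proof -
    have "12 * (\<Sum>w\<in>C. (u \<bullet> w)\<^sup>2 * (w \<bullet> v)\<^sup>2) =
       (\<Sum>w\<in>C. ((u + v) \<bullet> w) ^ 4) + (\<Sum>w\<in>C. ((u - v) \<bullet> w) ^ 4)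
       - 2 * (\<Sum>w\<in>C. (u \<bullet> w) ^ 4) - 2 * (\<Sum>w\<in>C. (v \<bullet> w) ^ 4)"
      unfolding sum_subtractf[symmetric] sum.distrib[symmetric] sum_distrib_left
      by (rule sum.cong)
        (simp_all add: inner_add_left inner_diff_left inner_commute[of _ v] power2_eq_square
          power4_eq_xxxx algebra_simps)
    also have "\<dots> = 3 * K * (((norm (u + v))\<^sup>2)\<^sup>2 + ((norm (u - v))\<^sup>2)\<^sup>2 - 2 * ((norm u)\<^sup>2)\<^sup>2 - 2 * ((norm v)\<^sup>2)\<^sup>2)"
      unfolding P4 by (simp add: algebra_simps)
    also have "(norm (u + v))\<^sup>2 = (norm u)\<^sup>2 + (norm v)\<^sup>2 + 2 * (u \<bullet> v)"
      by (simp add: power2_norm_eq_inner inner_add_left inner_add_right inner_commute)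
    also have "(norm (u - v))\<^sup>2 = (norm u)\<^sup>2 + (norm v)\<^sup>2 - 2 * (u \<bullet> v)"
      by (simp add: power2_norm_eq_inner inner_diff_left inner_diff_right inner_commute)
    finally show ?thesis by (simp add: algebra_simps power2_eq_square)
  qed
  have "N = (\<Sum>w\<in>C. (\<Sum>b\<in>Basis. (b \<bullet> w)\<^sup>2) * (\<Sum>c\<in>Basis. (w \<bullet> c)\<^sup>2))"
    by (simp add: sum_Basis_inner_squared N_def)
  also have "\<dots> = (\<Sum>b\<in>Basis. \<Sum>c\<in>Basis. \<Sum>w\<in>C. (b \<bullet> w)\<^sup>2 * (w \<bullet> c)\<^sup>2)"
    by (simp add: sum_product sum.swap[of _ _ C])
  also have "\<dots> = (\<Sum>b\<in>(Basis::(real^'n) set). \<Sum>c\<in>Basis. K * (1 + (if c = b then 2 else 0)))"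
    unfolding B by (intro sum.cong refl) (auto simp: inner_Basis)
  also have "\<dots> = K * (n * (n + 2))"
    by (simp add: sum.distrib DIM_eq n_def algebra_simps flip: sum_distrib_left)
  finally have "N = K * (n * (n + 2))" .
  moreover have "n * (n + 2) \<noteq> 0" using n_ge by simp
  ultimately have "K = N / (n * (n + 2))" by (metis nonzero_mult_div_cancel_right)
  with B show ?thesis by simp
qed

text \<open>
  A 3-distance 4-design carries a 3-class association scheme. The kernels \<open>E0, E1, E2, E3\<close> restricted
  to \<open>C\<close> are the primitive idempotents of its Bose--Mesner algebra, of ranks \<open>1, n, m2, m3\<close>.
\<close>

definition m2 :: real where "m2 = (n - 1) * (n + 2) / 2"
definition m3 :: real where "m3 = N - 1 - n - m2"

definition E0 :: "real^'n \<Rightarrow> real^'n \<Rightarrow> real" where "E0 u v = 1 / N"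
definition E1 :: "real^'n \<Rightarrow> real^'n \<Rightarrow> real" where "E1 u v = n / N * (u \<bullet> v)"
text \<open>The degree 2 zonal polynomial, scaled so that its matrix over \<open>C\<close> has trace
  \<open>m2\<close>.\<close>

definition E2 :: "real^'n \<Rightarrow> real^'n \<Rightarrow> real" where
  "E2 u v = n * (n + 2) / (2 * N) * ((u \<bullet> v)\<^sup>2 - 1 / n)"
definition Id :: "real^'n \<Rightarrow> real^'n \<Rightarrow> real" where "Id u v = (if u = v then 1 else 0)"
definition E3 :: "real^'n \<Rightarrow> real^'n \<Rightarrow> real" where "E3 u v = Id u v - E0 u v - E1 u v - E2 u v"

text \<open>The matrix product, with rows and columns indexed by \<open>C\<close>.\<close>

definition conv :: "(real^'n \<Rightarrow> real^'n \<Rightarrow> real) \<Rightarrow> (real^'n \<Rightarrow> real^'n \<Rightarrow> real) \<Rightarrow> real^'n \<Rightarrow> real^'n \<Rightarrow> real"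
  where "conv A B u v = (\<Sum>w\<in>C. A u w * B w v)"

lemma conv_Id_left: "u \<in> C \<Longrightarrow> conv Id B u v = B u v"
  using finC by (simp add: conv_def Id_def if_distrib[of "\<lambda>c. c * _"] cong: if_cong)

lemma conv_Id_right: "v \<in> C \<Longrightarrow> conv A Id u v = A u v"
  using finC by (simp add: conv_def Id_def if_distrib[of "\<lambda>c. _ * c"] cong: if_cong)

lemma power_sum_2': "(\<Sum>w\<in>C. (w \<bullet> u)\<^sup>2) = N / n * (norm u)\<^sup>2"
  using power_sum_2[of u] by (simp add: inner_commute)

lemma moment_1': "(\<Sum>w\<in>C. w \<bullet> u) = 0"
  using moment_1[of u] by (simp add: inner_commute)

lemma moment_3': "(\<Sum>w\<in>C. (u \<bullet> w) * (w \<bullet> v)\<^sup>2) = 0"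
  using moment_3[of v u] by (simp add: inner_commute mult.commute)

text \<open>Every product is a polynomial of degree at most 4 in the summation point, so the moments
  determine it; only \<open>E2\<close> with itself calls for the fourth moment.\<close>

lemma conv_E:
  assumes "u \<in> C" "v \<in> C"
  shows "conv E0 E0 u v = E0 u v" "conv E0 E1 u v = 0" "conv E0 E2 u v = 0"
    "conv E1 E0 u v = 0" "conv E1 E1 u v = E1 u v" "conv E1 E2 u v = 0"
    "conv E2 E0 u v = 0" "conv E2 E1 u v = 0" "conv E2 E2 u v = E2 u v"
proof -
  note pos = N_pos n_ge
  have N: "(\<Sum>w\<in>C. (1::real)) = N" by (simp add: N_def)
  show "conv E0 E0 u v = E0 u v"
    using pos by (simp add: conv_def E0_def flip: N_def)
  have "conv E0 E1 u v = 1 / N * (n / N) * (\<Sum>w\<in>C. w \<bullet> v)"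
    unfolding conv_def E0_def E1_def sum_distrib_left by simp
  then show "conv E0 E1 u v = 0" by (simp add: moment_1')
  show "conv E1 E0 u v = 0"
    unfolding conv_def E0_def E1_def
    by (simp add: moment_1 flip: sum_distrib_left sum_distrib_right sum_divide_distrib)
  have q: "(\<Sum>w\<in>C. (w \<bullet> v)\<^sup>2 - 1 / n) = 0" if "v \<in> C" for v
    using that pos unfolding sum_subtractf power_sum_2' by (simp flip: N_def)
  show "conv E0 E2 u v = 0"
    unfolding conv_def E0_def E2_def using q[OF assms(2)]
    by (simp only: sum_distrib_left[symmetric] mult_zero_right)
  have q': "(\<Sum>w\<in>C. (u \<bullet> w)\<^sup>2 - 1 / n) = 0"
    using q[OF assms(1)] by (simp add: inner_commute)
  show "conv E2 E0 u v = 0"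
    unfolding conv_def E0_def E2_def using q'
    by (simp only: sum_distrib_left[symmetric] sum_distrib_right[symmetric] mult_zero_left mult_zero_right)
  have "conv E1 E1 u v = (n / N)\<^sup>2 * (\<Sum>w\<in>C. (u \<bullet> w) * (w \<bullet> v))"
    unfolding conv_def E1_def sum_distrib_left by (simp add: power2_eq_square mult_ac)
  then show "conv E1 E1 u v = E1 u v"
    using pos unfolding moment_2 E1_def by (simp add: power2_eq_square)
  have "conv E1 E2 u v = n / N * (n * (n + 2) / (2 * N)) *
      ((\<Sum>w\<in>C. (u \<bullet> w) * (w \<bullet> v)\<^sup>2) - (\<Sum>w\<in>C. u \<bullet> w) / n)"
    unfolding conv_def E1_def E2_def sum_distrib_left sum_divide_distrib sum_subtractf[symmetric]
    by (intro sum.cong refl) (simp add: algebra_simps)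
  then show "conv E1 E2 u v = 0" by (simp add: moment_1 moment_3')
  have "conv E2 E1 u v = n / N * (n * (n + 2) / (2 * N)) *
      ((\<Sum>w\<in>C. (u \<bullet> w)\<^sup>2 * (w \<bullet> v)) - (\<Sum>w\<in>C. w \<bullet> v) / n)"
    unfolding conv_def E1_def E2_def sum_distrib_left sum_divide_distrib sum_subtractf[symmetric]
    by (intro sum.cong refl) (simp add: algebra_simps)
  then show "conv E2 E1 u v = 0" by (simp add: moment_1' moment_3)
  have "conv E2 E2 u v = (n * (n + 2) / (2 * N))\<^sup>2 *
      ((\<Sum>w\<in>C. (u \<bullet> w)\<^sup>2 * (w \<bullet> v)\<^sup>2) - (\<Sum>w\<in>C. (u \<bullet> w)\<^sup>2) / n - (\<Sum>w\<in>C. (w \<bullet> v)\<^sup>2) / n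
        + (\<Sum>w\<in>C. (1::real)) / n\<^sup>2)"
    unfolding conv_def E2_def sum_distrib_left sum_divide_distrib sum_subtractf[symmetric] sum.distrib[symmetric]
    by (intro sum.cong refl) (simp add: algebra_simps power2_eq_square)
  also have "\<dots> = (n * (n + 2) / (2 * N))\<^sup>2 * (2 * N / (n * (n + 2)) * ((u \<bullet> v)\<^sup>2 - 1 / n))"
  proof -
    have "N / (n * (n + 2)) * (1 + 2 * t) - N / n / n - N / n / n + N / n\<^sup>2 =
        2 * N / (n * (n + 2)) * (t - 1 / n)" for t
      using pos by (simp add: divide_simps) algebra
    then show ?thesis
      using assms unfolding moment_4 power_sum_2 power_sum_2' N by simp
  qed
  also have "\<dots> = E2 u v"
  proof -
    have "(D / (2 * N))\<^sup>2 * (2 * N / D * q) = D / (2 * N) * q" if "D \<noteq> 0" for D q :: real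
      using that pos by (simp add: power2_eq_square)
    then show ?thesis unfolding E2_def using pos by simp
  qed
  finally show "conv E2 E2 u v = E2 u v" .
qed

end


section \<open>Spectrum of the adjacency matrix of one inner product\<close>

locale three_distance_4_design = spherical_4_design C for C :: "(real^'n) set" +
  fixes a b c :: real
  assumes inner_products: "inner_products C = {a, b, c}" and distinct: "a \<noteq> b" "a \<noteq> c" "b \<noteq> c"
begin

lemma inner_cases:
  assumes "u \<in> C" "v \<in> C"
  shows "u = v \<or> u \<bullet> v = a \<or> u \<bullet> v = b \<or> u \<bullet> v = c"
proof (cases "u = v")
  case False
  then have "u \<bullet> v \<in> inner_products C"
    unfolding inner_products_def using assms by blast
  then show ?thesis using inner_products by auto
qed simp

lemma inner_attained:
  assumes "t \<in> {a, b, c}"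
  obtains u v where "u \<in> C" "v \<in> C" "u \<noteq> v" "u \<bullet> v = t"
  using assms unfolding inner_products[symmetric] inner_products_def by blast

lemma neq_1: "a \<noteq> 1" "b \<noteq> 1" "c \<noteq> 1"
  using inner_attained inner_eq_1_iff by (metis insertCI)+

definition M :: "real^'n \<Rightarrow> real^'n \<Rightarrow> real" where
  "M u v = (if u \<bullet> v = a then 1 else 0)"

text \<open>The polynomial \<open>lead * (t - b) * (t - c)\<close> is 1 at \<open>a\<close> and 0 at
  \<open>b, c\<close>. Expanding it in the zonal kernels yields the eigenvalues
  \<open>\<theta>0\<close>, \<open>\<theta>1\<close>, \<open>\<theta>2\<close>,
  \<open>\<theta>3\<close> of \<open>M\<close> on \<open>E0, E1, E2, E3\<close>;
  \<open>\<theta>3\<close> makes the diagonal of \<open>M\<close> vanish.\<close>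

definition lead :: real where "lead = 1 / ((a - b) * (a - c))"
definition \<theta>3 :: real where "\<theta>3 = - lead * (1 - b) * (1 - c)"
definition \<theta>0 :: real where "\<theta>0 = \<theta>3 + lead * N * (b * c + 1 / n)"
definition \<theta>1 :: real where "\<theta>1 = \<theta>3 - lead * (b + c) * N / n"
definition \<theta>2 :: real where "\<theta>2 = \<theta>3 + lead * (2 * N / (n * (n + 2)))"

text \<open>Lagrange interpolation at the nodes \<open>a, b, c\<close>, with a multiple of the identity
  correcting the value at \<open>1\<close>.\<close>

lemma M_eq:
  assumes "u \<in> C" "v \<in> C"
  shows "M u v = \<theta>3 * Id u v + (\<theta>0 - \<theta>3) * E0 u v + (\<theta>1 - \<theta>3) * E1 u v + (\<theta>2 - \<theta>3) * E2 u v"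
proof -
  define t where "t = u \<bullet> v"
  have "(\<theta>0 - \<theta>3) * E0 u v = lead * (b * c + 1 / n)"
    "(\<theta>1 - \<theta>3) * E1 u v = - lead * (b + c) * t"
    "(\<theta>2 - \<theta>3) * E2 u v = lead * (t\<^sup>2 - 1 / n)"
    using N_pos n_ge by (simp_all add: \<theta>0_def \<theta>1_def \<theta>2_def E0_def E1_def E2_def t_def)
  then have "(\<theta>0 - \<theta>3) * E0 u v + (\<theta>1 - \<theta>3) * E1 u v + (\<theta>2 - \<theta>3) * E2 u v
      = lead * (t - b) * (t - c)"
    by (simp add: algebra_simps power2_eq_square)
  moreover have "M u v = \<theta>3 * Id u v + lead * (t - b) * (t - c)"
  proof (cases "u = v")
    case True
    then show ?thesis using assms neq_1 by (simp add: t_def M_def Id_def \<theta>3_def)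
  next
    case False
    then show ?thesis
      using inner_cases[OF assms] distinct by (auto simp: t_def M_def Id_def lead_def)
  qed
  ultimately show ?thesis by simp
qed

lemma conv_M:
  assumes "u \<in> C" "v \<in> C"
  shows "conv M B u v = \<theta>3 * conv Id B u v + (\<theta>0 - \<theta>3) * conv E0 B u v
    + (\<theta>1 - \<theta>3) * conv E1 B u v + (\<theta>2 - \<theta>3) * conv E2 B u v"
  unfolding conv_def sum_distrib_left sum.distrib[symmetric] using assms
  by (intro sum.cong refl) (simp add: M_eq algebra_simps)

lemma conv_M_E:
  assumes "u \<in> C" "v \<in> C"
  shows "conv M E0 u v = \<theta>0 * E0 u v" "conv M E1 u v = \<theta>1 * E1 u v" "conv M E2 u v = \<theta>2 * E2 u v"
  using assms by (simp_all add: conv_M conv_E conv_Id_left algebra_simps)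

primrec Mpow :: "nat \<Rightarrow> real^'n \<Rightarrow> real^'n \<Rightarrow> real" where
  "Mpow 0 = Id"
| "Mpow (Suc j) = conv M (Mpow j)"

text \<open>The entries count walks; this is the source of all rationality.\<close>

lemma Mpow_rational: "Mpow j u v \<in> \<rat>"
proof (induction j arbitrary: u v)
  case 0
  show ?case by (simp add: Id_def)
next
  case (Suc j)
  have "M u w \<in> \<rat>" for w by (simp add: M_def)
  with Suc show ?case by (auto simp: conv_def intro!: Rats_sum Rats_mult)
qed

text \<open>The spectral decomposition with \<open>E3\<close> eliminated through \<open>Id\<close>,
  whence the differences of powers.\<close>

lemma Mpow_eq:
  assumes "u \<in> C" "v \<in> C"
  shows "Mpow j u v = \<theta>3 ^ j * Id u v + (\<theta>0 ^ j - \<theta>3 ^ j) * E0 u v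
    + (\<theta>1 ^ j - \<theta>3 ^ j) * E1 u v + (\<theta>2 ^ j - \<theta>3 ^ j) * E2 u v"
  using assms
proof (induction j arbitrary: u v)
  case (Suc j)
  have "Mpow (Suc j) u v = \<theta>3 ^ j * conv M Id u v + (\<theta>0 ^ j - \<theta>3 ^ j) * conv M E0 u v
    + (\<theta>1 ^ j - \<theta>3 ^ j) * conv M E1 u v + (\<theta>2 ^ j - \<theta>3 ^ j) * conv M E2 u v"
    unfolding Mpow.simps conv_def sum_distrib_left sum.distrib[symmetric]
    using Suc.IH[OF _ Suc.prems(2)]
    by (intro sum.cong refl) (simp only: distrib_left mult.left_commute[of "M u _"])
  also have "conv M Id u v = M u v" using Suc by (simp add: conv_Id_right)
  finally show ?case
    using Suc by (simp add: conv_M_E M_eq algebra_simps)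
qed simp

text \<open>The diagonal is constant on \<open>C\<close>, so \<open>N\<close> times one entry is the
  trace.\<close>

lemma Mpow_diag:
  assumes "u \<in> C"
  shows "N * Mpow j u u = \<theta>0 ^ j + n * \<theta>1 ^ j + m2 * \<theta>2 ^ j + m3 * \<theta>3 ^ j"
proof -
  have d: "N * E0 u u = 1" "N * E1 u u = n" "N * Id u u = N"
    using assms N_pos by (simp_all add: E0_def E1_def Id_def)
  have d2: "N * E2 u u = m2"
    using assms N_pos n_ge by (simp add: E2_def m2_def) (simp add: field_simps)
  have "N * Mpow j u u = \<theta>3 ^ j * (N * Id u u) + (\<theta>0 ^ j - \<theta>3 ^ j) * (N * E0 u u)
    + (\<theta>1 ^ j - \<theta>3 ^ j) * (N * E1 u u) + (\<theta>2 ^ j - \<theta>3 ^ j) * (N * E2 u u)"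
    using assms by (simp add: Mpow_eq algebra_simps)
  then show ?thesis unfolding d d2 by (simp add: m3_def algebra_simps)
qed

text \<open>Multiplying by the constant kernel \<open>E0\<close> forms row sums.\<close>

lemma valency:
  assumes "u \<in> C"
  shows "real (card {w \<in> C. u \<bullet> w = a}) = \<theta>0"
proof -
  have "conv M E0 u u = (\<Sum>w\<in>C. M u w) / N"
    unfolding conv_def by (simp add: E0_def sum_divide_distrib)
  also have "(\<Sum>w\<in>C. M u w) = real (card {w \<in> C. u \<bullet> w = a})"
    using finC by (simp add: M_def sum.If_cases Int_def)
  finally show ?thesis
    using conv_M_E(1)[OF assms assms] N_pos by (simp add: E0_def[of u u])
qed

lemma theta_pos: "\<theta>0 > 0"
proof -
  obtain u v where uv: "u \<in> C" "v \<in> C" "u \<bullet> v = a" using inner_attained[of a] by blast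
  then have "card {w \<in> C. u \<bullet> w = a} > 0"
    using finC by (auto simp: card_gt_0_iff)
  then show ?thesis using valency[OF uv(1)] by simp
qed

text \<open>On the diagonal of the product of \<open>M\<close> with a zonal kernel, only points at
  inner product \<open>a\<close> contribute, all with the same kernel value. Hence the eigenvalue
  divided by the valency is the zonal polynomial at \<open>a\<close>, normalized to be 1 at
  1.\<close>

lemma eigenvalues:
  shows "\<theta>1 = \<theta>0 * a" "\<theta>2 = \<theta>0 * ((n * a\<^sup>2 - 1) / (n - 1))"
proof -
  obtain u where u: "u \<in> C" using nonempty by blast
  have val: "(\<Sum>w\<in>C. M u w) = \<theta>0"
    using finC valency[OF u] by (simp add: M_def sum.If_cases Int_def)
  have "(\<Sum>w\<in>C. M u w * (w \<bullet> u)) = (\<Sum>w\<in>C. M u w) * a"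
    unfolding sum_distrib_right by (intro sum.cong) (simp_all add: M_def inner_commute)
  moreover have "conv M E1 u u = n / N * (\<Sum>w\<in>C. M u w * (w \<bullet> u))"
    unfolding conv_def E1_def sum_distrib_left by (simp add: mult_ac)
  ultimately show "\<theta>1 = \<theta>0 * a"
    using conv_M_E(2)[OF u u] u val N_pos n_ge by (simp add: E1_def)
  have "(\<Sum>w\<in>C. M u w * ((w \<bullet> u)\<^sup>2 - 1 / n)) = (\<Sum>w\<in>C. M u w) * (a\<^sup>2 - 1 / n)"
    unfolding sum_distrib_right by (intro sum.cong) (simp_all add: M_def inner_commute)
  moreover have "conv M E2 u u = n * (n + 2) / (2 * N) * (\<Sum>w\<in>C. M u w * ((w \<bullet> u)\<^sup>2 - 1 / n))"
    unfolding conv_def E2_def sum_distrib_left by (simp add: mult_ac)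
  moreover have "E2 u u = n * (n + 2) / (2 * N) * (1 - 1 / n)"
    using u by (simp add: E2_def)
  moreover have "n * (n + 2) / (2 * N) \<noteq> 0" using N_pos n_ge by simp
  ultimately have "\<theta>0 * (a\<^sup>2 - 1 / n) = \<theta>2 * (1 - 1 / n)"
    using conv_M_E(3)[OF u u] val by simp
  then have "\<theta>0 * (n * a\<^sup>2 - 1) = \<theta>2 * (n - 1)"
    using n_ge by (simp add: field_simps)
  then show "\<theta>2 = \<theta>0 * ((n * a\<^sup>2 - 1) / (n - 1))"
    using n_ge by (simp add: field_simps)
qed

text \<open>\<open>E3\<close> is symmetric and idempotent, so the squares in a row add up to the
  diagonal entry.\<close>

lemma E3_squares:
  assumes "u \<in> C"
  shows "(\<Sum>w\<in>C. (E3 u w)\<^sup>2) = m3 / N"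
proof -
  have sym: "E3 u w = E3 w u" for w
    by (simp add: E3_def E0_def E1_def E2_def Id_def inner_commute)
  have "(\<Sum>w\<in>C. (E3 u w)\<^sup>2) = conv E3 E3 u u"
    unfolding conv_def by (simp add: power2_eq_square flip: sym)
  also have "\<dots> = conv Id E3 u u - conv E0 E3 u u - conv E1 E3 u u - conv E2 E3 u u"
    unfolding conv_def sum_subtractf[symmetric] by (intro sum.cong refl) (simp add: E3_def algebra_simps)
  also have "conv Id E3 u u = E3 u u"
    using assms by (rule conv_Id_left)
  also have *: "conv A E3 u u = conv A Id u u - conv A E0 u u - conv A E1 u u - conv A E2 u u" for A
    unfolding conv_def sum_subtractf[symmetric] by (intro sum.cong refl) (simp add: E3_def algebra_simps)
  also have "E3 u u = m3 / N"
    using assms N_pos n_ge by (simp add: E3_def Id_def E0_def E1_def E2_def m3_def m2_def field_simps power2_eq_square)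
  finally show ?thesis
    using assms by (simp add: * conv_E conv_Id_right)
qed

text \<open>If \<open>E3\<close> vanished, the zonal polynomial of \<open>E0 + E1 + E2\<close>, which is quadratic, would have the
  three roots \<open>a, b, c\<close>.\<close>

lemma m3_pos: "m3 > 0"
proof (rule ccontr)
  assume m3: "\<not> m3 > 0"
  have E3: "E3 u w = 0" if "u \<in> C" "w \<in> C" for u w
  proof -
    have "(\<Sum>w\<in>C. (E3 u w)\<^sup>2) \<le> 0"
      using E3_squares[OF \<open>u \<in> C\<close>] m3 N_pos by (simp add: divide_le_0_iff)
    then have "(\<Sum>w\<in>C. (E3 u w)\<^sup>2) = 0"
      by (meson sum_nonneg zero_le_power2 order_antisym)
    then show ?thesis
      using finC that by (simp add: sum_nonneg_eq_0_iff)
  qed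
  define K where "K = n * (n + 2) / 2"
  have K: "K \<noteq> 0" using n_ge by (simp add: K_def)
  define q where "q t = 1 + n * t + K * (t\<^sup>2 - 1 / n)" for t
  have q: "q t = 0" if "t \<in> {a, b, c}" for t
  proof -
    obtain u v where uv: "u \<in> C" "v \<in> C" "u \<noteq> v" "u \<bullet> v = t" using inner_attained[OF \<open>t \<in> _\<close>] .
    then have "N * (E0 u v + E1 u v + E2 u v) = 0"
      using E3[of u v] by (simp add: E3_def Id_def)
    then show ?thesis
      using N_pos uv by (simp add: E0_def E1_def E2_def q_def K_def distrib_left)
  qed
  \<comment> \<open>Divided differences at the roots: two of them contradict each other because
    \<open>b \<noteq> c\<close>.\<close>
  have "(a - b) * (K * (a + b) + n) = q a - q b"
    "(a - c) * (K * (a + c) + n) = q a - q c"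
    by (simp_all add: q_def algebra_simps power2_eq_square)
  then have "K * (a + b) + n = 0" "K * (a + c) + n = 0"
    using q distinct by simp_all
  moreover have "K * (b - c) = (K * (a + b) + n) - (K * (a + c) + n)"
    by (simp add: algebra_simps)
  ultimately have "K * (b - c) = 0" by simp
  then show False using distinct K by simp
qed

lemma n_rational: "n \<in> \<rat>" and N_rational: "N \<in> \<rat>" and m2_rational: "m2 \<in> \<rat>" and m3_rational: "m3 \<in> \<rat>"
proof -
  show n: "n \<in> \<rat>" and N: "N \<in> \<rat>" by (simp_all add: n_def N_def)
  then show m2: "m2 \<in> \<rat>" unfolding m2_def by simp
  with n N show "m3 \<in> \<rat>" by (simp add: m3_def)
qed

text \<open>The traces of the powers of \<open>M\<close> divided by its valency are rational;
  removing the eigenvalue 1 leaves the power sums of \<open>irrational_eigenvalue\<close>.\<close>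

lemma irrational_inner_product:
  assumes "a \<notin> \<rat>"
  shows "m3 = n" "a\<^sup>2 = 1 / (n + 2)"
proof -
  obtain u where u: "u \<in> C" using nonempty by blast
  define y z where "y = (n * a\<^sup>2 - 1) / (n - 1)" and "z = \<theta>3 / \<theta>0"
  have k: "\<theta>0 \<in> \<rat>" using valency[OF u] by (metis Rats_of_nat)
  have k0: "\<theta>0 \<noteq> 0" using theta_pos by simp
  have S: "1 + n * a ^ j + m2 * y ^ j + m3 * z ^ j = N * Mpow j u u / \<theta>0 ^ j" for j
  proof -
    have "\<theta>0 ^ j * (1 + n * a ^ j + m2 * y ^ j + m3 * z ^ j) =
        \<theta>0 ^ j + n * (\<theta>0 * a) ^ j + m2 * (\<theta>0 * y) ^ j + m3 * (\<theta>0 * z) ^ j"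
      by (simp add: algebra_simps power_mult_distrib)
    also have "\<dots> = N * Mpow j u u"
      using k0 by (simp add: Mpow_diag[OF u] eigenvalues y_def z_def)
    finally show ?thesis using k0 by (simp add: field_simps)
  qed
  have "Mpow 1 u u = 0"
    using u neq_1 by (simp add: conv_Id_right M_def)
  then have S1: "n * a + m2 * y + m3 * z = -1"
    using S[of 1] by simp
  have "n * a ^ j + m2 * y ^ j + m3 * z ^ j \<in> \<rat>" for j
  proof -
    have "n * a ^ j + m2 * y ^ j + m3 * z ^ j = N * Mpow j u u / \<theta>0 ^ j - 1"
      using S[of j] by simp
    also have "\<dots> \<in> \<rat>" using k N_rational Mpow_rational by simp
    finally show ?thesis .
  qed
  note irr = irrational_eigenvalue[OF n_ge n_rational m2_def m3_pos m3_rational y_def this S1 assms]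
  then show "m3 = n" "a\<^sup>2 = 1 / (n + 2)" by auto
qed

end


section \<open>Orthonormal frames and coordinates for the icosahedron\<close>

lemma orthonormal_parseval:
  fixes B :: "'a::euclidean_space set"
  assumes B: "pairwise orthogonal B" "\<And>b. b \<in> B \<Longrightarrow> norm b = 1" "finite B" "card B = DIM('a)"
  shows "(\<Sum>b\<in>B. (u \<bullet> b) * (v \<bullet> b)) = u \<bullet> v"
proof -
  have "0 \<notin> B" using B(2) by fastforce
  then have "independent B" using B by (intro pairwise_orthogonal_independent)
  then have "u \<in> span B" for u
    using card_ge_dim_independent[of B UNIV] B by auto
  then have "u = (\<Sum>b\<in>B. (u \<bullet> b) *\<^sub>R b)"
    using orthonormal_basis_expand[OF B(1,2) _ B(3)] by metis
  then have "u \<bullet> v = (\<Sum>b\<in>B. (u \<bullet> b) *\<^sub>R b) \<bullet> v" by simp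
  also have "\<dots> = (\<Sum>b\<in>B. (u \<bullet> b) * (v \<bullet> b))"
    by (simp add: inner_sum_left inner_commute[of v])
  finally show ?thesis by simp
qed

lemma orthonormal_triple_parseval:
  fixes x y z :: "real^'n"
  assumes "CARD('n) = 3" "x \<bullet> x = 1" "y \<bullet> y = 1" "z \<bullet> z = 1" "x \<bullet> y = 0" "x \<bullet> z = 0" "y \<bullet> z = 0"
  shows "(u \<bullet> x) * (v \<bullet> x) + (u \<bullet> y) * (v \<bullet> y) + (u \<bullet> z) * (v \<bullet> z) = u \<bullet> v"
proof -
  have d: "x \<noteq> y" "x \<noteq> z" "y \<noteq> z" using assms by auto
  have "(\<Sum>b\<in>{x, y, z}. (u \<bullet> b) * (v \<bullet> b)) = u \<bullet> v"
    using assms d by (intro orthonormal_parseval)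
      (auto simp: pairwise_def orthogonal_def inner_commute norm_eq_1)
  then show ?thesis using d by simp
qed

lemma golden_ratio_squared: "golden_ratio\<^sup>2 = golden_ratio + 1"
  unfolding golden_ratio_def by (simp add: power2_eq_square field_simps)

lemma golden_ratio_gt_1: "golden_ratio > 1"
  unfolding golden_ratio_def by (simp add: field_simps)

lemma icosahedron_vertex:
  assumes "a \<in> {1, -1}" "b \<in> {golden_ratio, - golden_ratio}"
  shows "vector [0, a, b] /\<^sub>R sqrt (1 + golden_ratio\<^sup>2) \<in> icosahedron"
    "vector [b, 0, a] /\<^sub>R sqrt (1 + golden_ratio\<^sup>2) \<in> icosahedron"
    "vector [a, b, 0] /\<^sub>R sqrt (1 + golden_ratio\<^sup>2) \<in> icosahedron"
  unfolding icosahedron_def using assms by blast+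

text \<open>The upper bound suffices: an injective image of 12 points inside the icosahedron must
  fill it.\<close>

lemma card_icosahedron_le: "finite icosahedron" "card icosahedron \<le> 12"
proof -
  let ?f = "\<lambda>v. v /\<^sub>R sqrt (1 + golden_ratio\<^sup>2)"
  define F :: "real \<times> real \<Rightarrow> (real^3) list" where
    "F = (\<lambda>(a, b). map ?f [vector [0, a, b], vector [b, 0, a], vector [a, b, 0]])"
  define xs where "xs = concat (map F [(1, golden_ratio), (1, - golden_ratio),
    (-1, golden_ratio), (-1, - golden_ratio)])"
  have "icosahedron = set xs"
    unfolding icosahedron_def xs_def F_def by auto
  moreover have "length xs = 12" by (simp add: xs_def F_def)
  ultimately show "finite icosahedron" "card icosahedron \<le> 12"
    using card_length[of xs] by (metis List.finite_set, simp)
qed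

text \<open>
  The vertex of the icosahedron whose inner products with the three vertices \<open>(0, \<plusminus>1, \<phi>)\<close> and
  \<open>(\<phi>, 0, 1)\<close> of a face, before scaling, are \<open>p\<close>, \<open>q\<close> and \<open>r\<close>; here \<open>\<phi> - 1 = 1 / \<phi>\<close>.
\<close>

definition face_coords :: "real \<Rightarrow> real \<Rightarrow> real \<Rightarrow> real^3" where
  "face_coords p q r =
     vector [(r - (p + q) / 2 * (golden_ratio - 1)) * (golden_ratio - 1), (p - q) / 2,
       (p + q) / 2 * (golden_ratio - 1)]"

text \<open>The six triples are the face vertices and their antipodes. Of the eight sign patterns,
  the norm condition excludes the two constant ones; the other six give the remaining
  vertices.\<close>

lemma face_coords_in_icosahedron:
  fixes p q r :: real
  defines "\<phi> \<equiv> golden_ratio"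
  assumes cases: "(p, q, r) \<in> {(\<phi> + 2, \<phi>, \<phi>), (\<phi>, \<phi> + 2, \<phi>), (\<phi>, \<phi>, \<phi> + 2),
      (- \<phi> - 2, - \<phi>, - \<phi>), (- \<phi>, - \<phi> - 2, - \<phi>), (- \<phi>, - \<phi>, - \<phi> - 2)}
      \<or> p \<in> {\<phi>, - \<phi>} \<and> q \<in> {\<phi>, - \<phi>} \<and> r \<in> {\<phi>, - \<phi>}"
    and norm: "face_coords p q r \<bullet> face_coords p q r = 1 + \<phi>\<^sup>2"
  shows "face_coords p q r /\<^sub>R sqrt (1 + golden_ratio\<^sup>2) \<in> icosahedron"
proof -
  have sq: "\<phi> * \<phi> = \<phi> + 1" using golden_ratio_squared by (simp add: \<phi>_def power2_eq_square)
  have gt: "\<phi> > 1" using golden_ratio_gt_1 by (simp add: \<phi>_def)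
  define P where "P v \<longleftrightarrow> v /\<^sub>R sqrt (1 + golden_ratio\<^sup>2) \<in> icosahedron" for v
  have P: "P (vector [0, a, b])" "P (vector [b, 0, a])" "P (vector [a, b, 0])"
    if "a \<in> {1, -1}" "b \<in> {\<phi>, - \<phi>}" for a b
    using icosahedron_vertex that unfolding P_def \<phi>_def by blast+
  have c: "face_coords p q r = vector [(r - (p + q) / 2 * (\<phi> - 1)) * (\<phi> - 1), (p - q) / 2, (p + q) / 2 * (\<phi> - 1)]"
    unfolding face_coords_def \<phi>_def ..
  have I: "vector [a1, a2, a3] = (vector [b1, b2, b3] :: real^3)" if "a1 = b1" "a2 = b2" "a3 = b3"
    for a1 a2 a3 b1 b2 b3 :: real using that by simp
  \<comment> \<open>For a constant pattern the norm condition reads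
    \<open>6 - 3 * \<phi> = \<phi> + 2\<close>, that is \<open>\<phi> = 1\<close>.\<close>
  have no: False if "p = q" "q = r" "r \<in> {\<phi>, - \<phi>}"
  proof -
    have r: "r * r = \<phi> + 1" using that sq by auto
    have "face_coords p q r \<bullet> face_coords p q r =
        (r * r) * (((1 - (\<phi> - 1)) * (\<phi> - 1))\<^sup>2 + (\<phi> - 1)\<^sup>2)"
      unfolding c using that by (simp add: inner_vec_def sum_3 algebra_simps power2_eq_square)
    then have "(\<phi> + 1) * (((1 - (\<phi> - 1)) * (\<phi> - 1))\<^sup>2 + (\<phi> - 1)\<^sup>2) = 1 + \<phi>\<^sup>2"
      using norm r by simp
    moreover have "(\<phi> + 1) * (((1 - (\<phi> - 1)) * (\<phi> - 1))\<^sup>2 + (\<phi> - 1)\<^sup>2) = 6 - 3 * \<phi>"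
      using sq by algebra
    moreover have "1 + \<phi>\<^sup>2 = \<phi> + 2" using sq by (simp add: power2_eq_square)
    ultimately show False using gt by simp
  qed
  have sq': "\<phi> * (\<phi> * t) = \<phi> * t + t" for t
    using sq by (metis distrib_right mult.assoc mult_1)
  have eq: "face_coords p q r = vector [v1, v2, v3]"
    if "(r - (p + q) / 2 * (\<phi> - 1)) * (\<phi> - 1) = v1" "(p - q) / 2 = v2" "(p + q) / 2 * (\<phi> - 1) = v3"
    for p q r v1 v2 v3
    using that by (simp add: face_coords_def \<phi>_def)
  have "face_coords (\<phi> + 2) \<phi> \<phi> = vector [0, 1, \<phi>]"
    "face_coords (- \<phi> - 2) (- \<phi>) (- \<phi>) = vector [0, -1, - \<phi>]"
    "face_coords \<phi> (\<phi> + 2) \<phi> = vector [0, -1, \<phi>]"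
    "face_coords (- \<phi>) (- \<phi> - 2) (- \<phi>) = vector [0, 1, - \<phi>]"
    "face_coords \<phi> \<phi> (\<phi> + 2) = vector [\<phi>, 0, 1]"
    "face_coords (- \<phi>) (- \<phi>) (- \<phi> - 2) = vector [- \<phi>, 0, -1]"
    "face_coords \<phi> \<phi> (- \<phi>) = vector [- \<phi>, 0, 1]"
    "face_coords (- \<phi>) (- \<phi>) \<phi> = vector [\<phi>, 0, -1]"
    "face_coords \<phi> (- \<phi>) \<phi> = vector [1, \<phi>, 0]"
    "face_coords \<phi> (- \<phi>) (- \<phi>) = vector [-1, \<phi>, 0]"
    "face_coords (- \<phi>) \<phi> \<phi> = vector [1, - \<phi>, 0]"
    "face_coords (- \<phi>) \<phi> (- \<phi>) = vector [-1, - \<phi>, 0]"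
    by (rule eq; simp add: field_simps sq sq')+
  then have "P (face_coords (\<phi> + 2) \<phi> \<phi>)" "P (face_coords (- \<phi> - 2) (- \<phi>) (- \<phi>))"
    "P (face_coords \<phi> (\<phi> + 2) \<phi>)" "P (face_coords (- \<phi>) (- \<phi> - 2) (- \<phi>))"
    "P (face_coords \<phi> \<phi> (\<phi> + 2))" "P (face_coords (- \<phi>) (- \<phi>) (- \<phi> - 2))"
    "P (face_coords \<phi> \<phi> (- \<phi>))" "P (face_coords (- \<phi>) (- \<phi>) \<phi>)"
    "P (face_coords \<phi> (- \<phi>) \<phi>)" "P (face_coords \<phi> (- \<phi>) (- \<phi>))"
    "P (face_coords (- \<phi>) \<phi> \<phi>)" "P (face_coords (- \<phi>) \<phi> (- \<phi>))"
    using P by auto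
  then show ?thesis using cases no unfolding P_def by auto
qed


section \<open>Parameters of a design with an irrational inner product\<close>

context three_distance_4_design
begin

lemma sum_by_inner_product:
  assumes "u \<in> C"
  shows "(\<Sum>w\<in>C. f (u \<bullet> w) :: real) = f 1 + real (card {w \<in> C. u \<bullet> w = a}) * f a
    + real (card {w \<in> C. u \<bullet> w = b}) * f b + real (card {w \<in> C. u \<bullet> w = c}) * f c"
proof -
  define A where "A t = {w \<in> C. u \<bullet> w = t}" for t
  have fin: "finite (A t)" for t using finC by (simp add: A_def)
  have A: "(\<Sum>w\<in>A t. f (u \<bullet> w)) = real (card (A t)) * f t" for t
    by (simp add: A_def)
  have "A 1 = {u}" using assms inner_eq_1_iff by (auto simp: A_def)
  then have A1: "(\<Sum>w\<in>A 1. f (u \<bullet> w)) = f 1" using assms by simp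
  have "C = A 1 \<union> (A a \<union> (A b \<union> A c))"
  proof -
    have "w \<in> A 1 \<union> (A a \<union> (A b \<union> A c))" if "w \<in> C" for w
      using inner_cases[OF assms that] that assms by (auto simp: A_def)
    then show ?thesis by (auto simp: A_def)
  qed
  then have "(\<Sum>w\<in>C. f (u \<bullet> w)) = (\<Sum>w\<in>A 1 \<union> (A a \<union> (A b \<union> A c)). f (u \<bullet> w))"
    by simp
  also have "\<dots> = (\<Sum>w\<in>A 1. f (u \<bullet> w)) + ((\<Sum>w\<in>A a. f (u \<bullet> w)) +
      ((\<Sum>w\<in>A b. f (u \<bullet> w)) + (\<Sum>w\<in>A c. f (u \<bullet> w))))"
  proof -
    have "A s \<inter> A t = {}" if "s \<noteq> t" for s t using that by (auto simp: A_def)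
    then show ?thesis
      using neq_1[symmetric] distinct fin by (simp add: sum.union_disjoint Int_Un_distrib)
  qed
  finally show ?thesis unfolding A1 unfolding A by (simp add: A_def)
qed

text \<open>Makes the results on \<open>a\<close> available for \<open>b\<close> and
  \<open>c\<close>.\<close>

lemma permuted:
  "three_distance_4_design C b a c" "three_distance_4_design C c a b"
  using three_distance_4_design_axioms
  by (auto simp: three_distance_4_design_def three_distance_4_design_axioms_def insert_commute)

text \<open>All irrational inner products have the same square. If neither \<open>b\<close> nor
  \<open>c\<close> were \<open>- a\<close>, both would be rational, and the first moment would force
  the positive valency of \<open>a\<close> to vanish.\<close>

lemma irrational_opposite:
  assumes "a \<notin> \<rat>"
  shows "b = - a \<or> c = - a"
proof (rule ccontr)
  assume no: "\<not> ?thesis"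
  have b: "b \<in> \<rat>"
    using three_distance_4_design.irrational_inner_product(2)[OF permuted(1)]
      irrational_inner_product(2)[OF assms] no distinct by (metis power2_eq_iff)
  have c: "c \<in> \<rat>"
    using three_distance_4_design.irrational_inner_product(2)[OF permuted(2)]
      irrational_inner_product(2)[OF assms] no distinct by (metis power2_eq_iff)
  obtain u where u: "u \<in> C" using nonempty by blast
  define k where "k t = real (card {w \<in> C. u \<bullet> w = t})" for t
  have k: "k t \<in> \<rat>" for t by (simp add: k_def)
  have "(\<Sum>w\<in>C. u \<bullet> w) = 1 + k a * a + k b * b + k c * c"
    using sum_by_inner_product[OF u, of "\<lambda>t. t"] by (simp add: k_def)
  then have "k a * a + (1 + k b * b + k c * c) = 0"
    by (simp add: moment_1)
  then have "k a = 0"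
    using b c k assms by (intro Rats_affine_irrational[of _ a "1 + k b * b + k c * c"]) auto
  then show False using valency[OF u] theta_pos by (simp add: k_def)
qed

lemma icosahedral_parameters:
  assumes "a \<notin> \<rat>" "b = - a"
  shows "n = 3" "N = 12" "c = -1" "a\<^sup>2 = 1 / 5"
proof -
  note a = irrational_inner_product[OF assms(1)]
  have c: "c \<in> \<rat>"
    using three_distance_4_design.irrational_inner_product(2)[OF permuted(2)] a(2) assms distinct
    by (metis power2_eq_iff)
  obtain u where u: "u \<in> C" using nonempty by blast
  define k where "k t = real (card {w \<in> C. u \<bullet> w = t})" for t
  have kQ: "k t \<in> \<rat>" for t by (simp add: k_def)
  note S = sum_by_inner_product[OF u, folded k_def]
  have S1: "(k a - k b) * a + (1 + k c * c) = 0"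
    using S[of "\<lambda>t. t"] moment_1[of u] assms(2) by (simp add: algebra_simps)
  then have kab: "k a = k b"
    using Rats_affine_irrational[of "k a - k b" a "1 + k c * c"] kQ c assms by auto
  with S1 have c1: "k c * c = -1" by simp
  \<comment> \<open>With equal valencies the contributions of \<open>a\<close> and
    \<open>- a\<close> cancel in the odd moments; comparing the first and third gives
    \<open>c\<^sup>2 = 1\<close>.\<close>
  have "1 + k a * a ^ 3 + k b * (- a) ^ 3 + k c * c ^ 3 = 0"
    using S[of "\<lambda>t. t ^ 3"] power_sum_odd[of 3 u] assms(2) by simp
  then have "(k c * c) * c\<^sup>2 = -1"
    using kab by (simp add: power3_eq_cube power2_eq_square)
  then have "c\<^sup>2 = 1" using c1 by simp
  then show cc: "c = -1" using neq_1 by (simp add: power2_eq_1_iff)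
  then have kc: "k c = 1" using c1 by simp
  have N: "N = 2 + 2 * k a"
    using S[of "\<lambda>t. 1"] kab kc by (simp add: N_def)
  have "N / n = 2 + 2 * k a * a\<^sup>2"
    using S[of "\<lambda>t. t\<^sup>2"] power_sum_2[of u] u kab kc cc assms(2) by (simp add: algebra_simps)
  then have "N / n = 2 + (N - 2) * (1 / (n + 2))" using N a by simp
  then have "N * (n + 2) = n * (2 * (n + 2) + (N - 2))"
    using n_ge by (simp add: divide_simps)
  then have N2: "N = n\<^sup>2 + n" by (simp add: algebra_simps power2_eq_square)
  \<comment> \<open>A second formula for \<open>N\<close>, from the rank \<open>m3 = n\<close>;
    together with the one from the second moment it determines \<open>n\<close>.\<close>
  have "N = 1 + 2 * n + m2" using a(1) by (simp add: m3_def)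
  then have "n * (n - 3) = 0"
    using N2 by (simp add: m2_def field_simps power2_eq_square)
  then show n3: "n = 3" using n_ge by simp
  show "N = 12" using N2 n3 by simp
  show "a\<^sup>2 = 1 / 5" using a(2) n3 by simp
qed

end


section \<open>Identification with the icosahedron\<close>

context three_distance_4_design
begin

text \<open>Three points at mutual inner product \<open>h\<close> span the space. The possible inner
  products with them confine every point of \<open>C\<close>, in a suitable frame, to the standard
  vertices.\<close>

lemma isometric_icosahedron:
  assumes "a \<notin> \<rat>" "b = - a"
  shows "isometric_sets C icosahedron"
proof -
  note par = icosahedral_parameters[OF assms]
  define \<phi> where "\<phi> = golden_ratio"
  define s where "s = sqrt (1 + \<phi>\<^sup>2)"
  \<comment> \<open>This is the positive one of \<open>a, - a\<close>; the sign of \<open>a\<close>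
    itself is left open.\<close>
  define h where "h = \<phi> / (\<phi> + 2)"
  have sq: "\<phi>\<^sup>2 = \<phi> + 1" using golden_ratio_squared by (simp add: \<phi>_def)
  have gt: "\<phi> > 1" using golden_ratio_gt_1 by (simp add: \<phi>_def)
  have s2: "s\<^sup>2 = \<phi> + 2" using sq gt by (simp add: s_def)
  have s0: "s > 0" using sq gt by (simp add: s_def)
  have sh: "s\<^sup>2 * h = \<phi>" using gt by (simp add: s2 h_def)
  have h0: "h > 0" using gt by (simp add: h_def)
  have "(\<phi> + 2)\<^sup>2 * h\<^sup>2 = \<phi>\<^sup>2" using gt by (simp add: h_def power_divide)
  moreover have "5 * \<phi>\<^sup>2 = (\<phi> + 2)\<^sup>2" using sq by algebra
  ultimately have "(\<phi> + 2)\<^sup>2 * (5 * h\<^sup>2) = (\<phi> + 2)\<^sup>2 * 1" by algebra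
  moreover have "(\<phi> + 2)\<^sup>2 \<noteq> 0" using gt by simp
  ultimately have "5 * h\<^sup>2 = 1" using mult_left_cancel by blast
  then have h2: "h\<^sup>2 = 1 / 5" by simp
  have ah: "a = h \<or> a = - h"
    using par(4) h2 by (metis power2_eq_iff)
  have ip: "u = v \<or> u \<bullet> v = h \<or> u \<bullet> v = - h \<or> v = - u" if "u \<in> C" "v \<in> C" for u v
  proof -
    have "v = - u" if "u \<bullet> v = -1"
    proof -
      have "(u + v) \<bullet> (u + v) = 0"
        using that \<open>u \<in> C\<close> \<open>v \<in> C\<close> by (simp add: inner_add_left inner_add_right inner_commute)
      then show ?thesis by (simp add: eq_neg_iff_add_eq_0 add.commute)
    qed
    then show ?thesis
      using inner_cases[OF that] ah par assms by auto
  qed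
  have h1: "h < 1" using gt by (simp add: h_def)
  \<comment> \<open>The valencies do not depend on the point, so each inner product occurs at every
    point; for \<open>c = -1\<close> this gives antipodes.\<close>
  have val: "\<exists>w\<in>C. u \<bullet> w = t" if "u \<in> C" "t \<in> {a, b, c}" for u t
  proof -
    interpret b: three_distance_4_design C b a c by (rule permuted)
    interpret c: three_distance_4_design C c a b by (rule permuted)
    have "card {w \<in> C. u \<bullet> w = t} \<noteq> 0"
      using valency[OF \<open>u \<in> C\<close>] b.valency[OF \<open>u \<in> C\<close>] c.valency[OF \<open>u \<in> C\<close>]
        theta_pos b.theta_pos c.theta_pos that by auto
    then show ?thesis by (auto simp: card_eq_0_iff)
  qed
  have neg: "- u \<in> C" if u: "u \<in> C" for u
  proof -
    obtain w where w: "w \<in> C" "u \<bullet> w = -1" using val[OF u, of c] par by auto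
    then have "w = - u"
      using ip[OF u \<open>w \<in> C\<close>] u h0 h1 by auto
    then show ?thesis using w by simp
  qed
  obtain x where x: "x \<in> C" using nonempty by blast
  obtain y where y: "y \<in> C" "x \<bullet> y = h" using val[OF x, of h] ah assms by auto
  have ne_minus: "u \<noteq> - u" if "u \<in> C" for u
  proof
    assume "u = - u"
    then have "u \<bullet> u = - (u \<bullet> u)" by (metis inner_minus_right)
    then show False using that by simp
  qed
  have "x \<noteq> - y" "- x \<noteq> y"
    using x y h0 by force+
  moreover have "x \<noteq> y" using x y h1 by auto
  ultimately have xy: "x \<noteq> y" "x \<noteq> - y" "- x \<noteq> y" "- x \<noteq> - y" "x \<noteq> - x" "y \<noteq> - y"
    using ne_minus[OF x] ne_minus[OF y(1)] by auto
  \<comment> \<open>By the second moment, the products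
    \<open>(x \<bullet> w) * (w \<bullet> y)\<close> sum to \<open>4 * h\<close>, which
    \<open>x, - x, y, - y\<close> already contribute. Over the other eight points the sum is 0, so
    some \<open>w\<close> has equal inner products with \<open>x\<close> and \<open>y\<close>, and
    \<open>w\<close> or \<open>- w\<close> serves as \<open>z\<close>.\<close>
  obtain z where z: "z \<in> C" "x \<bullet> z = h" "y \<bullet> z = h"
  proof -
    define R where "R = C - {x, - x, y, - y}"
    have sub: "{x, - x, y, - y} \<subseteq> C" using x y neg by simp
    have c4: "card {x, - x, y, - y} = 4" using xy by simp
    have "(\<Sum>w\<in>C. (x \<bullet> w) * (w \<bullet> y)) = 4 * h"
      using moment_2[of x y] par y by simp
    moreover have "(\<Sum>w\<in>{x, - x, y, - y}. (x \<bullet> w) * (w \<bullet> y)) = 4 * h"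
      using xy x y by simp
    ultimately have R0: "(\<Sum>w\<in>R. (x \<bullet> w) * (w \<bullet> y)) = 0"
      unfolding R_def using finC sub by (subst sum_diff) auto
    have "card R = 8"
      unfolding R_def using finC sub c4 par by (subst card_Diff_subset) (auto simp: N_def)
    then have "R \<noteq> {}" by auto
    have Rv: "(x \<bullet> w = h \<or> x \<bullet> w = - h) \<and> (y \<bullet> w = h \<or> y \<bullet> w = - h)" if "w \<in> R" for w
      using that ip[OF x, of w] ip[OF y(1), of w] by (auto simp: R_def)
    have "\<exists>w\<in>R. x \<bullet> w = y \<bullet> w"
    proof (rule ccontr)
      assume no: "\<not> ?thesis"
      have "(\<Sum>w\<in>R. (x \<bullet> w) * (w \<bullet> y)) < (\<Sum>w\<in>R. 0)"
      proof (rule sum_strict_mono)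
        show "(x \<bullet> w) * (w \<bullet> y) < 0" if "w \<in> R" for w
          using Rv[OF that] no that h0 by (auto simp: inner_commute[of w])
      qed (use \<open>R \<noteq> {}\<close> finC R_def in auto)
      with R0 show False by simp
    qed
    then obtain w where w: "w \<in> R" "x \<bullet> w = y \<bullet> w" by blast
    then have "w \<in> C" by (simp add: R_def)
    from Rv[OF w(1)] w(2) consider "x \<bullet> w = h" | "x \<bullet> w = - h" by blast
    then show thesis
    proof cases
      case 1
      then show ?thesis using that[of w] w \<open>w \<in> C\<close> by simp
    next
      case 2
      then show ?thesis using that[of "- w"] w neg[OF \<open>w \<in> C\<close>] by simp
    qed
  qed
  \<comment> \<open>The factor \<open>s\<^sup>2\<close> passes from the unit sphere to the unscaled
    icosahedron of circumradius \<open>s\<close>, as \<open>face_coords\<close> expects.\<close>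
  define p q r where "p w = s\<^sup>2 * (x \<bullet> w)" and "q w = s\<^sup>2 * (y \<bullet> w)" and "r w = s\<^sup>2 * (z \<bullet> w)" for w
  txt \<open>\<open>X1, X2, X3\<close> is the orthonormal frame in which the triangle \<open>x, y, z\<close> becomes a face of the
    standard icosahedron.\<close>
  define X2 where "X2 = (s / 2) *\<^sub>R (x - y)"
  define X3 where "X3 = (s * (\<phi> - 1) / 2) *\<^sub>R (x + y)"
  define X1 where "X1 = (\<phi> - 1) *\<^sub>R (s *\<^sub>R z - X3)"
  note ix = x y z innerC[OF x] innerC[OF y(1)] innerC[OF z(1)]
    y(2)[THEN trans[OF inner_commute]] z(2)[THEN trans[OF inner_commute]] z(3)[THEN trans[OF inner_commute]]
  note bil = inner_add_left inner_add_right inner_diff_left inner_diff_right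
  have X22: "X2 \<bullet> X2 = 1"
  proof -
    have "X2 \<bullet> X2 = (s\<^sup>2 - s\<^sup>2 * h) / 2"
      by (simp add: X2_def bil ix power2_eq_square algebra_simps)
    then show ?thesis by (simp add: sh) (simp add: s2)
  qed
  have X33: "X3 \<bullet> X3 = 1"
  proof -
    have "X3 \<bullet> X3 = (s\<^sup>2 + s\<^sup>2 * h) / 2 * (\<phi> - 1)\<^sup>2"
      by (simp add: X3_def bil ix power2_eq_square algebra_simps)
    also have "\<dots> = (\<phi> + 1) * (\<phi> - 1)\<^sup>2" unfolding sh unfolding s2 by simp
    also have "\<dots> = 1" using sq by algebra
    finally show ?thesis .
  qed
  have "(x - y) \<bullet> (x + y) = 0" by (simp add: bil ix)
  then have X23: "X2 \<bullet> X3 = 0" by (simp add: X2_def X3_def)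
  have zX2: "z \<bullet> X2 = 0" by (simp add: X2_def bil ix)
  have zX3: "s * (z \<bullet> X3) = 1"
  proof -
    have "s * (z \<bullet> X3) = (s\<^sup>2 * h) * (\<phi> - 1)"
      by (simp add: X3_def bil ix power2_eq_square)
    also have "\<dots> = 1" unfolding sh using sq by algebra
    finally show ?thesis .
  qed
  have X12: "X1 \<bullet> X2 = 0"
    using X23 by (simp add: X1_def bil zX2 inner_commute[of X3 X2])
  have X13: "X1 \<bullet> X3 = 0"
    by (simp add: X1_def bil zX3 X33)
  have X11: "X1 \<bullet> X1 = 1"
  proof -
    have "X1 \<bullet> X1 = (\<phi> - 1)\<^sup>2 * (s\<^sup>2 * (z \<bullet> z) - 2 * (s * (z \<bullet> X3)) + X3 \<bullet> X3)"
      by (simp add: X1_def bil inner_commute[of X3 z] power2_eq_square algebra_simps)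
    also have "\<dots> = (\<phi> - 1)\<^sup>2 * (\<phi> + 1)" by (simp add: zX3 X33 ix s2)
    also have "\<dots> = 1" using sq by algebra
    finally show ?thesis .
  qed
  have "CARD('n) = 3" using par(1) by (simp add: n_def)
  note parseval = orthonormal_triple_parseval[OF this X11 X22 X33 X12 X13 X23]
  define T :: "real^'n \<Rightarrow> real^3" where "T w = vector [w \<bullet> X1, w \<bullet> X2, w \<bullet> X3]" for w
  have TT: "T u \<bullet> T v = u \<bullet> v" for u v
    using parseval[of u v] by (simp add: T_def inner_vec_def sum_3)
  have dist: "dist (T u) (T v) = dist u v" for u v
  proof -
    have "(dist (T u) (T v))\<^sup>2 = (dist u v)\<^sup>2"
      unfolding dist_norm power2_norm_eq_inner bil TT ..
    then show ?thesis by (simp add: power2_eq_iff_nonneg)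
  qed
  have sT: "face_coords (p w) (q w) (r w) = s *\<^sub>R T w" for w
  proof -
    have "w \<bullet> X2 = s / 2 * (x \<bullet> w - y \<bullet> w)" "w \<bullet> X3 = s * (\<phi> - 1) / 2 * (x \<bullet> w + y \<bullet> w)"
      by (simp_all add: X2_def X3_def bil inner_commute)
    then have "s * (w \<bullet> X2) = (p w - q w) / 2"
      "s * (w \<bullet> X3) = (p w + q w) / 2 * (\<phi> - 1)"
      unfolding p_def q_def by algebra+
    moreover have "s * (w \<bullet> X1) = (r w - s * (w \<bullet> X3)) * (\<phi> - 1)"
      by (simp add: X1_def bil r_def inner_commute power2_eq_square algebra_simps)
    ultimately have "s *\<^sub>R T w = face_coords (p w) (q w) (r w)"
      by (simp add: T_def face_coords_def vec_eq_iff forall_3 flip: \<phi>_def)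
    then show ?thesis by simp
  qed
  have T_eq: "face_coords (p w) (q w) (r w) /\<^sub>R s = T w" for w
    using s0 by (simp add: sT)
  have TC: "T w \<in> icosahedron" if w: "w \<in> C" for w
  proof -
    have nrm: "face_coords (p w) (q w) (r w) \<bullet> face_coords (p w) (q w) (r w) = 1 + \<phi>\<^sup>2"
      using w sq s2 by (simp add: sT TT power2_eq_square)
    have sh': "s\<^sup>2 * - h = - \<phi>" using sh by simp
    have vals: "p x = \<phi> + 2" "q y = \<phi> + 2" "r z = \<phi> + 2"
      "q x = \<phi>" "r x = \<phi>" "p y = \<phi>" "r y = \<phi>" "p z = \<phi>" "q z = \<phi>"
      by (simp_all only: p_def q_def r_def ix sh) (simp_all add: s2)
    have minus: "p (- v) = - p v" "q (- v) = - q v" "r (- v) = - r v" for v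
      by (simp_all add: p_def q_def r_def)
    have "(p w, q w, r w) \<in> {(\<phi> + 2, \<phi>, \<phi>), (\<phi>, \<phi> + 2, \<phi>), (\<phi>, \<phi>, \<phi> + 2),
        (- \<phi> - 2, - \<phi>, - \<phi>), (- \<phi>, - \<phi> - 2, - \<phi>), (- \<phi>, - \<phi>, - \<phi> - 2)}
      \<or> p w \<in> {\<phi>, - \<phi>} \<and> q w \<in> {\<phi>, - \<phi>} \<and> r w \<in> {\<phi>, - \<phi>}"
    proof -
      consider "x = w" | "y = w" | "z = w" | "w = - x" | "w = - y" | "w = - z"
        | "x \<bullet> w = h \<or> x \<bullet> w = - h" "y \<bullet> w = h \<or> y \<bullet> w = - h" "z \<bullet> w = h \<or> z \<bullet> w = - h"
        using ip[OF x w] ip[OF y(1) w] ip[OF z(1) w] by blast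
      then show ?thesis
      proof cases
        case 1
        show ?thesis unfolding 1[symmetric] vals by simp
      next
        case 2
        show ?thesis unfolding 2[symmetric] vals by simp
      next
        case 3
        show ?thesis unfolding 3[symmetric] vals by simp
      next
        case 4
        show ?thesis unfolding 4 minus vals by simp
      next
        case 5
        show ?thesis unfolding 5 minus vals by simp
      next
        case 6
        show ?thesis unfolding 6 minus vals by simp
      next
        case 7
        have "p w \<in> {\<phi>, - \<phi>}" using 7(1) sh sh' by (auto simp: p_def)
        moreover have "q w \<in> {\<phi>, - \<phi>}" using 7(2) sh sh' by (auto simp: q_def)
        moreover have "r w \<in> {\<phi>, - \<phi>}" using 7(3) sh sh' by (auto simp: r_def)
        ultimately show ?thesis by blast
      qed
    qed
    from face_coords_in_icosahedron[OF this[unfolded \<phi>_def] nrm[unfolded \<phi>_def]]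
    show ?thesis using T_eq[of w] by (simp add: s_def \<phi>_def)
  qed
  have inj: "inj_on T C"
    by (rule inj_onI) (metis dist dist_eq_0_iff)
  have "card (T ` C) = 12"
    using par(2) card_image[OF inj] by (simp add: N_def)
  then have "T ` C = icosahedron"
    using TC card_icosahedron_le by (intro card_seteq) auto
  then have "bij_betw T C icosahedron"
    using inj by (simp add: bij_betw_def)
  then show ?thesis
    unfolding isometric_sets_def using dist by blast
qed

end

theorem theorem3p2:
  fixes C :: "(real^'n) set"
  assumes "CARD('n) \<ge> 3"
    and "distance_set 3 C"
    and "spherical_design 4 C"
  shows "(\<forall>x\<in>C. \<forall>y\<in>C. x \<bullet> y \<in> \<rat>) \<or> (CARD('n) = 3 \<and> isometric_sets C icosahedron)"
proof (cases "\<forall>x\<in>C. \<forall>y\<in>C. x \<bullet> y \<in> \<rat>")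
  case False
  then obtain x y where xy: "x \<in> C" "y \<in> C" "x \<bullet> y \<notin> \<rat>" by blast
  have nonempty: "C \<noteq> {}" using xy by blast
  interpret spherical_4_design C
    by standard (use assms nonempty in auto)
  have "x \<noteq> y" using xy by auto
  then have mem: "x \<bullet> y \<in> inner_products C"
    unfolding inner_products_def using xy by blast
  have card3: "card (inner_products C) = 3"
    using assms(2) by (simp add: distance_set_def)
  define a where "a = x \<bullet> y"
  have "card (inner_products C - {a}) = 2"
    using card3 mem by (simp add: a_def card_Diff_singleton)
  then obtain b c where bc: "inner_products C - {a} = {b, c}" "b \<noteq> c"
    by (meson card_2_iff)
  have abc: "inner_products C = {a, b, c}" "a \<noteq> b" "a \<noteq> c"
    using bc mem by (auto simp: a_def)
  have a: "a \<notin> \<rat>" using xy by (simp add: a_def)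
  have bc: "three_distance_4_design C a b c" and cb: "three_distance_4_design C a c b"
    by (standard; use abc bc in auto)+
  \<comment> \<open>Swapping \<open>b\<close> and \<open>c\<close> if necessary puts
    \<open>- a\<close> in second place.\<close>
  from three_distance_4_design.irrational_opposite[OF bc a]
  obtain b' c' where D: "three_distance_4_design C a b' c'" and "b' = - a"
    using bc cb by blast
  interpret D: three_distance_4_design C a b' c' by (rule D)
  note D.icosahedral_parameters(1)[OF a \<open>b' = - a\<close>] D.isometric_icosahedron[OF a \<open>b' = - a\<close>]
  then show ?thesis
    by (simp add: n_def)
qed simp

end
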